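(* There exists an effective $\mathbb Z$-subshift $Y$ such that the problem "$Y\hookrightarrow X$ for SFT inputs $X$" is decidable but $\mathcal L(Y)$ is not computable (and therefore the problem "$Y\subseteq X$ for SFT inputs $X$" is not decidable).
   Context: For a finite alphabet $\mathcal A$, $\mathbb Z$ acts on $\mathcal A^{\mathbb Z}$ by $\sigma^u(x)(v)=x(v+u)$. A pattern is a function $p\colon S\to\mathcal A$ with $S\subset\mathbb Z$ finite; it appears in $x$ if $\sigma^u(x)|_S=p$ for some $u$. For a set $\mathcal F$ of patterns, $X_{\mathcal F}$ is the set of configurations in which no pattern from $\mathcal F$ appears. A $\mathbb Z$-subshift is a set of the form $X_{\mathcal F}$ (possibly empty); it is an SFT if $\mathcal F$ can be taken finite, and effective if $\mathcal F$ can be taken recursively enumerable. The language $\mathcal L(Y)$ is the set of patterns appearing in some configuration of $Y$. $Y\hookrightarrow X$ means there is an embedding, i.e. a continuous, shift-commuting, injective map $Y\to X$. The subshift $Y$ is a fixed parameter. The input is a $\mathbb Z$-SFT $X$, specified by an alphabet and a finite set of forbidden patterns, and the problem is to determine whether the stated relation holds. *)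

theory Defs
  imports "HOL-Analysis.Function_Topology" "HOL-Library.Nat_Bijection"
begin

section \<open>Partial recursive functions\<close>

datatype recf =
    Zero
  | Succ
  | Proj nat
  | Comp recf "recf list"
  | PrimRec recf recf
  | Mu recf

text \<open>
  \<open>computes f xs y\<close>: the Kleene partial recursive function denoted by \<open>f\<close> is defined on \<open>xs\<close>,
  with value \<open>y\<close>. Programs carry no arity: \<open>Zero\<close> and \<open>Succ\<close> ignore surplus arguments, which does
  not change the class of functions of any fixed arity. In \<open>PrimRec\<close> and \<open>Mu\<close> the
  recursion/search variable is the first argument.
\<close>

inductive computes :: "recf \<Rightarrow> nat list \<Rightarrow> nat \<Rightarrow> bool" where
  Zero: "computes Zero xs 0"
| Succ: "computes Succ (x # xs) (Suc x)"
| Proj: "i < length xs \<Longrightarrow> computes (Proj i) xs (xs ! i)"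
| Comp: "list_all2 (\<lambda>g y. computes g xs y) gs ys \<Longrightarrow> computes f ys z \<Longrightarrow> computes (Comp f gs) xs z"
| PrimRec_0: "computes f xs y \<Longrightarrow> computes (PrimRec f g) (0 # xs) y"
| PrimRec_Suc: "computes (PrimRec f g) (n # xs) y \<Longrightarrow> computes g (n # y # xs) z
    \<Longrightarrow> computes (PrimRec f g) (Suc n # xs) z"
| Mu: "computes f (n # xs) 0 \<Longrightarrow> (\<And>m. m < n \<Longrightarrow> \<exists>k. computes f (m # xs) (Suc k))
    \<Longrightarrow> computes (Mu f) xs n"

lemma computes_functional: "computes f xs y \<Longrightarrow> computes f xs z \<Longrightarrow> y = z"
proof (induction arbitrary: z rule: computes.induct)
  case (Comp xs gs ys f z)
  from Comp.prems obtain ys' where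
    ys': "list_all2 (\<lambda>g y. computes g xs y) gs ys'" "computes f ys' z"
    by (cases rule: computes.cases) auto
  have "ys = ys'"
    using Comp.IH(1) ys'(1) by (auto simp: list_all2_conv_all_nth intro!: nth_equalityI)
  with ys'(2) Comp.IH(2) show ?case by simp
next
  case (PrimRec_Suc f g n xs y z)
  from PrimRec_Suc.prems PrimRec_Suc.IH show ?case
    by (cases rule: computes.cases) blast
next
  case (Mu f n xs)
  from Mu.prems have z: "computes f (z # xs) 0" "\<And>m. m < z \<Longrightarrow> \<exists>k. computes f (m # xs) (Suc k)"
    by (cases rule: computes.cases; auto)+
  have "\<not> z < n" using Mu.IH(2) z(1) by fastforce
  moreover have "\<not> n < z" using Mu.IH(1) z(2) by fastforce
  ultimately show ?case by simp
qed (erule computes.cases; simp)+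

definition decidable_set :: "nat set \<Rightarrow> bool" where
  "decidable_set D \<longleftrightarrow> (\<exists>f. \<forall>n. computes f [n] (if n \<in> D then 1 else 0))"

definition rec_enumerable :: "nat set \<Rightarrow> bool" where
  "rec_enumerable D \<longleftrightarrow> (\<exists>f. D = {n. \<exists>y. computes f [n] y})"

section \<open>Subshifts\<close>

text \<open>
  Letters are natural numbers and an alphabet is a finite set of letters. A pattern with support
  \<open>S\<close> is a partial function with finite domain \<open>S\<close>.
\<close>

type_synonym config = "int \<Rightarrow> nat"
type_synonym pattern = "int \<rightharpoonup> nat"

definition shift :: "int \<Rightarrow> config \<Rightarrow> config" where
  "shift u x = (\<lambda>v. x (v + u))"

definition appears :: "pattern \<Rightarrow> config \<Rightarrow> bool" where
  "appears p x \<longleftrightarrow> (\<exists>u. (Some \<circ> shift u x) |` dom p = p)"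

definition patterns :: "nat set \<Rightarrow> pattern set" where
  "patterns A = {p. finite (dom p) \<and> ran p \<subseteq> A}"

definition avoiding :: "nat set \<Rightarrow> pattern set \<Rightarrow> config set" where
  "avoiding A F = {x. range x \<subseteq> A \<and> (\<forall>p\<in>F. \<not> appears p x)}"

definition language :: "config set \<Rightarrow> pattern set" where
  "language Y = {p. finite (dom p) \<and> (\<exists>x\<in>Y. appears p x)}"

text \<open>
  Continuity refers to the library's product topology on \<^typ>\<open>int \<Rightarrow> nat\<close> with \<^typ>\<open>nat\<close> discrete;
  on configurations over a finite alphabet it induces the usual product topology.
\<close>

definition embeds :: "config set \<Rightarrow> config set \<Rightarrow> bool" (infix \<open>\<hookrightarrow>\<close> 50) where
  "Y \<hookrightarrow> X \<longleftrightarrow> (\<exists>\<phi>. \<phi> ` Y \<subseteq> X \<and> continuous_on Y \<phi> \<and> inj_on \<phi> Y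
     \<and> (\<forall>u. \<forall>x\<in>Y. \<phi> (shift u x) = shift u (\<phi> x)))"

section \<open>Codes and decision problems\<close>

definition pattern_code :: "pattern \<Rightarrow> nat" where
  "pattern_code p = set_encode ((\<lambda>(v, a). prod_encode (int_encode v, a)) ` Map.graph p)"

definition effective_subshift :: "config set \<Rightarrow> bool" where
  "effective_subshift Y \<longleftrightarrow> (\<exists>A F. finite A \<and> F \<subseteq> patterns A
     \<and> rec_enumerable (pattern_code ` F) \<and> Y = avoiding A F)"

text \<open>An SFT is given as an alphabet together with a finite set of forbidden patterns.\<close>

definition sft_inputs :: "(nat set \<times> pattern set) set" where
  "sft_inputs = {(A, F). finite A \<and> finite F \<and> F \<subseteq> patterns A}"

definition sft_code :: "nat set \<times> pattern set \<Rightarrow> nat" where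
  "sft_code = (\<lambda>(A, F). prod_encode (set_encode A, set_encode (pattern_code ` F)))"

definition decidable_for_sfts :: "(config set \<Rightarrow> bool) \<Rightarrow> bool" where
  "decidable_for_sfts P \<longleftrightarrow>
     decidable_set (sft_code ` {(A, F) \<in> sft_inputs. P (avoiding A F)})"

definition computable_patterns :: "pattern set \<Rightarrow> bool" where
  "computable_patterns L \<longleftrightarrow> decidable_set (pattern_code ` L)"

lemma inj_on_pattern_code: "inj_on pattern_code {p. finite (dom p)}"
proof (rule inj_onI)
  fix p q :: pattern
  assume fin: "p \<in> {p. finite (dom p)}" "q \<in> {p. finite (dom p)}"
    and eq: "pattern_code p = pattern_code q"
  let ?e = "\<lambda>(v, a). prod_encode (int_encode v, a)"
  have inj: "inj ?e"
    by (auto simp: inj_def dest: injD[OF inj_int_encode])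
  have "?e ` Map.graph p = ?e ` Map.graph q"
    using eq fin unfolding pattern_code_def
    by (subst (asm) set_encode_eq) (auto simp: finite_graph_iff_finite_dom)
  hence "Map.graph p = Map.graph q"
    using inj by (simp add: inj_image_eq_iff)
  thus "p = q"
    by (simp add: graph_def set_eq_iff) (metis not_Some_eq ext)
qed

lemma inj_on_sft_code: "inj_on sft_code sft_inputs"
proof (rule inj_onI, clarify)
  fix A B :: "nat set" and F G :: "pattern set"
  assume AF: "(A, F) \<in> sft_inputs" and BG: "(B, G) \<in> sft_inputs"
    and eq: "sft_code (A, F) = sft_code (B, G)"
  have "A = B" and FG: "pattern_code ` F = pattern_code ` G"
    using AF BG eq by (auto simp: sft_code_def sft_inputs_def set_encode_eq)
  moreover have "F \<subseteq> {p. finite (dom p)}" "G \<subseteq> {p. finite (dom p)}"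
    using AF BG by (auto simp: sft_inputs_def patterns_def)
  ultimately show "A = B \<and> F = G"
    using inj_on_image_eq_iff[OF inj_on_pattern_code] by blast
qed

end

theory Submission
  imports Defs
begin

text \<open>
  Let \<open>K\<close> be the halting set, and let \<open>Y\<close> consist of the 0-1-configurations in which two ones never
  have an even distance, nor a distance \<open>2 m + 1\<close> with \<open>m \<in> K\<close>. Then a configuration in \<open>Y\<close> has at
  most two ones, and deciding whether two ones at distance \<open>2 m + 1\<close> occur in \<open>Y\<close> amounts to deciding
  \<open>K\<close>.

  But \<open>Y\<close> embeds into an SFT \<open>X\<close> if and only if \<open>X\<close> contains a homoclinic point: a configuration
  that differs from a constant one at finitely many positions, but at least at one. The point of
  \<open>Y\<close> with a single one is mapped to such a point. Conversely, given a homoclinic point, one copy of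
  its nonconstant part is put at each of the ones; the finitely many orbits of \<open>Y\<close> for which these
  copies would interfere consist of isolated points, and are sent to pairs of copies at even
  distances. Which distances occur in \<open>Y\<close> is irrelevant here. By pumping, a homoclinic point may be
  taken of bounded length, so that a bounded search decides whether there is one.
\<close>

section \<open>Closure properties of recursive functions\<close>

text \<open>
  Variables are read off an environment \<open>e :: nat \<Rightarrow> nat\<close>; since programs may ignore surplus
  arguments, the threshold \<open>N\<close> removes all bookkeeping of arities.
\<close>

definition recursive_fun :: "((nat \<Rightarrow> nat) \<Rightarrow> nat) \<Rightarrow> bool" where
  "recursive_fun f \<longleftrightarrow> (\<exists>p N. \<forall>n\<ge>N. \<forall>e. computes p (map e [0..<n]) (f e))"

definition recursive_pred :: "((nat \<Rightarrow> nat) \<Rightarrow> bool) \<Rightarrow> bool" where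
  "recursive_pred P \<longleftrightarrow> recursive_fun (\<lambda>e. of_bool (P e))"

section \<open>Basic functions, substitution and primitive recursion\<close>

lemma recursive_fun_var: "recursive_fun (\<lambda>e. e i)"
  unfolding recursive_fun_def
proof (intro exI allI impI)
  fix n e assume "Suc i \<le> n"
  then show "computes (Proj i) (map e [0..<n]) (e i)"
    using computes.Proj[of i "map e [0..<n]"] by simp
qed

lemma recursive_fun_zero: "recursive_fun (\<lambda>e. 0)"
  unfolding recursive_fun_def by (blast intro: computes.Zero)

lemma recursive_fun_Suc:
  assumes "recursive_fun f"
  shows "recursive_fun (\<lambda>e. Suc (f e))"
proof -
  obtain p N where p: "\<And>n e. n \<ge> N \<Longrightarrow> computes p (map e [0..<n]) (f e)"
    using assms unfolding recursive_fun_def by blast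
  have "computes (Comp Succ [p]) (map e [0..<n]) (Suc (f e))" if "n \<ge> N" for n e
    by (rule computes.Comp[where ys = "[f e]"]) (use p[OF that] in \<open>auto intro: computes.Succ\<close>)
  then show ?thesis unfolding recursive_fun_def by blast
qed

lemma recursive_fun_const: "recursive_fun (\<lambda>e. c)"
  by (induction c) (auto intro: recursive_fun_zero recursive_fun_Suc)

text \<open>The program of \<open>f\<close> can be run on just its first \<open>N\<close> variables,
  so only finitely many of the \<open>g i\<close> have to be computed; the sum of their thresholds
  is a threshold for the composition.\<close>

lemma recursive_fun_comp:
  assumes "recursive_fun f" and "\<And>i. recursive_fun (g i)"
  shows "recursive_fun (\<lambda>e. f (\<lambda>i. g i e))"
proof -
  obtain p N where p: "\<And>n e. n \<ge> N \<Longrightarrow> computes p (map e [0..<n]) (f e)"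
    using assms(1) unfolding recursive_fun_def by blast
  have "\<forall>i. \<exists>q M. \<forall>n\<ge>M. \<forall>e. computes q (map e [0..<n]) (g i e)"
    using assms(2) unfolding recursive_fun_def by blast
  then obtain q M where q: "\<And>i n e. n \<ge> M i \<Longrightarrow> computes (q i) (map e [0..<n]) (g i e)"
    by metis
  have "computes (Comp p (map q [0..<N])) (map e [0..<n]) (f (\<lambda>i. g i e))"
    if n: "n \<ge> (\<Sum>i<N. M i)" for n e
  proof (rule computes.Comp)
    show "computes p (map (\<lambda>i. g i e) [0..<N]) (f (\<lambda>i. g i e))"
      by (rule p) simp
    have "M i \<le> n" if "i < N" for i
      using member_le_sum[of i "{..<N}" M] that n by simp
    then show "list_all2 (\<lambda>h y. computes h (map e [0..<n]) y) (map q [0..<N]) (map (\<lambda>i. g i e) [0..<N])"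
      by (auto simp: list_all2_conv_all_nth intro!: q)
  qed
  then show ?thesis unfolding recursive_fun_def by blast
qed

lemma recursive_fun_comp1:
  assumes "recursive_fun (\<lambda>e. f (e 0))" and "recursive_fun a"
  shows "recursive_fun (\<lambda>e. f (a e))"
  using recursive_fun_comp[OF assms(1), of "\<lambda>_. a"] assms by simp

lemma recursive_fun_comp2:
  assumes "recursive_fun (\<lambda>e. f (e 0) (e 1))" and "recursive_fun a" and "recursive_fun b"
  shows "recursive_fun (\<lambda>e. f (a e) (b e))"
  using recursive_fun_comp[OF assms(1), of "\<lambda>i. if i = 0 then a else b"] assms by simp

text \<open>Renaming for binders: a parameter used under a bound variable has to skip position 0. A
  recursion step binds two variables and calls for this twice.\<close>

lemma recursive_fun_lift:
  assumes "recursive_fun f"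
  shows "recursive_fun (\<lambda>e. f (\<lambda>i. e (Suc i)))"
  using assms by (rule recursive_fun_comp) (rule recursive_fun_var)

text \<open>In the step function the counter and the previous value are variables 0 and 1, and the
  parameters move up by two. The recursion runs on a fixed number \<open>K\<close> of parameters,
  supplied by projections, whatever the length of the actual argument list.\<close>

lemma recursive_fun_primrec:
  assumes "recursive_fun f" and "recursive_fun (\<lambda>e. g (e 0) (e 1) (\<lambda>i. e (Suc (Suc i))))" and "recursive_fun b"
  shows "recursive_fun (\<lambda>e. rec_nat (f e) (\<lambda>k r. g k r e) (b e))"
proof -
  obtain p N where p: "\<And>n e. n \<ge> N \<Longrightarrow> computes p (map e [0..<n]) (f e)"
    using assms(1) unfolding recursive_fun_def by blast
  obtain q M where q: "\<And>n e. n \<ge> M \<Longrightarrow>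
      computes q (map e [0..<n]) (g (e 0) (e 1) (\<lambda>i. e (Suc (Suc i))))"
    using assms(2) unfolding recursive_fun_def by blast
  obtain s L where s: "\<And>n e. n \<ge> L \<Longrightarrow> computes s (map e [0..<n]) (b e)"
    using assms(3) unfolding recursive_fun_def by blast
  let ?R = "\<lambda>e. rec_nat (f e) (\<lambda>k r. g k r e)"
  define K where "K = max N M"
  have step: "computes q (k # r # map e [0..<K]) (g k r e)" for k r e
  proof -
    have "k # r # map e [0..<K] = map (case_nat k (case_nat r e)) [0..<Suc (Suc K)]"
      by (simp add: map_upt_Suc del: upt_Suc)
    then show ?thesis
      using q[of "Suc (Suc K)" "case_nat k (case_nat r e)"] by (simp add: K_def)
  qed
  have R: "computes (PrimRec p q) (k # map e [0..<K]) (?R e k)" for k e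
  proof (induction k)
    case 0
    show ?case by (simp add: computes.PrimRec_0 p K_def)
  next
    case (Suc k)
    show ?case by (simp add: computes.PrimRec_Suc[OF Suc step])
  qed
  have "computes (Comp (PrimRec p q) (s # map Proj [0..<K])) (map e [0..<n]) (?R e (b e))"
    if n: "n \<ge> max L K" for n e
  proof (rule computes.Comp[OF _ R])
    have "computes (Proj i) (map e [0..<n]) (e i)" if "i < K" for i
      using computes.Proj[of i "map e [0..<n]"] that n by simp
    then show "list_all2 (\<lambda>h y. computes h (map e [0..<n]) y) (s # map Proj [0..<K])
        (b e # map e [0..<K])"
      using n s by (simp add: list_all2_map1 list_all2_map2 list_all2_same)
  qed
  then show ?thesis unfolding recursive_fun_def by blast
qed

section \<open>Arithmetic operations and pairing\<close>

lemma recursive_fun_add: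
  assumes "recursive_fun a" and "recursive_fun b"
  shows "recursive_fun (\<lambda>e. a e + b e)"
proof -
  have eq: "x + y = rec_nat x (\<lambda>k r. Suc r) y" for x y :: nat
    by (induction y) auto
  show ?thesis
    unfolding eq by (intro recursive_fun_primrec recursive_fun_Suc recursive_fun_var assms)
qed

lemma recursive_fun_mult:
  assumes "recursive_fun a" and "recursive_fun b"
  shows "recursive_fun (\<lambda>e. a e * b e)"
proof -
  have eq: "x * y = rec_nat 0 (\<lambda>k r. r + x) y" for x y :: nat
    by (induction y) auto
  show ?thesis
    unfolding eq
    by (intro recursive_fun_primrec recursive_fun_const recursive_fun_add recursive_fun_var assms
        recursive_fun_lift[OF recursive_fun_lift[OF assms(1)]])
qed

lemma recursive_fun_power:
  assumes "recursive_fun a" and "recursive_fun b"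
  shows "recursive_fun (\<lambda>e. a e ^ b e)"
proof -
  have eq: "x ^ y = rec_nat 1 (\<lambda>k r. r * x) y" for x y :: nat
    by (induction y) auto
  show ?thesis
    unfolding eq
    by (intro recursive_fun_primrec recursive_fun_const recursive_fun_mult recursive_fun_var assms
        recursive_fun_lift[OF recursive_fun_lift[OF assms(1)]])
qed

lemma recursive_fun_diff:
  assumes "recursive_fun a" and "recursive_fun b"
  shows "recursive_fun (\<lambda>e. a e - b e)"
proof -
  have pred: "x - 1 = rec_nat 0 (\<lambda>k r. k) x" for x :: nat
    by (cases x) auto
  have "recursive_fun (\<lambda>e. e 0 - 1)"
    unfolding pred by (intro recursive_fun_primrec recursive_fun_const recursive_fun_var)
  then have p: "recursive_fun f \<Longrightarrow> recursive_fun (\<lambda>e. f e - 1)" for f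
    by (rule recursive_fun_comp1)
  have sub: "x - y = rec_nat x (\<lambda>k r. r - 1) y" for x y :: nat
    by (induction y) auto
  have eq: "(\<lambda>e. a e - b e) = (\<lambda>e. rec_nat (a e) (\<lambda>k r. r - 1) (b e))"
    by (rule ext) (rule sub)
  show ?thesis
    unfolding eq by (intro recursive_fun_primrec p recursive_fun_var assms)
qed

lemma recursive_fun_triangle:
  assumes "recursive_fun a"
  shows "recursive_fun (\<lambda>e. triangle (a e))"
proof -
  have eq: "triangle x = rec_nat 0 (\<lambda>k r. r + Suc k) x" for x
    by (induction x) auto
  show ?thesis
    unfolding eq
    by (intro recursive_fun_primrec recursive_fun_const recursive_fun_add recursive_fun_Suc recursive_fun_var assms)
qed

lemma recursive_fun_prod_encode:
  assumes "recursive_fun a" and "recursive_fun b"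
  shows "recursive_fun (\<lambda>e. prod_encode (a e, b e))"
  unfolding prod_encode_def prod.case by (intro recursive_fun_add recursive_fun_triangle assms)

section \<open>Recursive predicates and bounded quantifiers\<close>

lemma recursive_pred_less:
  assumes "recursive_fun a" and "recursive_fun b"
  shows "recursive_pred (\<lambda>e. a e < b e)"
proof -
  have eq: "(of_bool (x < y) :: nat) = 1 - (1 - (y - x))" for x y :: nat by simp
  show ?thesis unfolding recursive_pred_def eq
    by (intro recursive_fun_diff recursive_fun_const assms)
qed

lemma recursive_pred_not:
  assumes "recursive_pred P"
  shows "recursive_pred (\<lambda>e. \<not> P e)"
proof -
  have eq: "(\<lambda>e. of_bool (\<not> P e)) = (\<lambda>e. 1 - of_bool (P e) :: nat)"
    by (rule ext) (simp add: of_bool_def)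
  show ?thesis
    unfolding recursive_pred_def eq by (intro recursive_fun_diff recursive_fun_const assms[unfolded recursive_pred_def])
qed

lemma recursive_pred_conj:
  assumes "recursive_pred P" and "recursive_pred Q"
  shows "recursive_pred (\<lambda>e. P e \<and> Q e)"
  using assms unfolding recursive_pred_def of_bool_conj by (rule recursive_fun_mult)

lemma recursive_pred_disj:
  assumes "recursive_pred P" and "recursive_pred Q"
  shows "recursive_pred (\<lambda>e. P e \<or> Q e)"
  using recursive_pred_not[OF recursive_pred_conj[OF recursive_pred_not[OF assms(1)] recursive_pred_not[OF assms(2)]]]
  by simp

lemma recursive_pred_imp:
  assumes "recursive_pred P" and "recursive_pred Q"
  shows "recursive_pred (\<lambda>e. P e \<longrightarrow> Q e)"
  using recursive_pred_disj[OF recursive_pred_not[OF assms(1)] assms(2)] by simp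

lemma recursive_pred_le:
  assumes "recursive_fun a" and "recursive_fun b"
  shows "recursive_pred (\<lambda>e. a e \<le> b e)"
  using recursive_pred_not[OF recursive_pred_less[OF assms(2,1)]] by (simp add: not_less)

lemma recursive_pred_eq:
  assumes "recursive_fun a" and "recursive_fun b"
  shows "recursive_pred (\<lambda>e. a e = b e)"
  unfolding order_eq_iff by (intro recursive_pred_conj recursive_pred_le assms)

text \<open>Primitive recursion counts the witnesses below the bound; there is one if and only if
  the count is positive.\<close>

lemma recursive_pred_ex:
  assumes "recursive_pred (\<lambda>e. P (e 0) (\<lambda>i. e (Suc i)))" and "recursive_fun b"
  shows "recursive_pred (\<lambda>e. \<exists>i<b e. P i e)"
proof -
  have eq: "(\<exists>i<n. P i e) \<longleftrightarrow> (0::nat) < rec_nat 0 (\<lambda>k r. r + of_bool (P k e)) n" for n e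
  proof (induction n)
    case (Suc n)
    have "(\<exists>i<Suc n. P i e) \<longleftrightarrow> (\<exists>i<n. P i e) \<or> P n e"
      by (metis less_Suc_eq)
    with Suc.IH show ?case
      by (cases "P n e") simp_all
  qed simp
  \<comment> \<open>The quantifier binds one variable but the recursion binds two, so the renaming
    leaves out position 1, which holds the running count.\<close>
  have "recursive_fun (\<lambda>e. of_bool (P (e 0) (\<lambda>i. e (Suc (Suc i)))))"
    using recursive_fun_comp[OF assms(1)[unfolded recursive_pred_def], of "\<lambda>i e. e (if i = 0 then 0 else Suc i)"]
      recursive_fun_var by simp
  then show ?thesis
    unfolding eq
    by (intro recursive_pred_less recursive_fun_primrec recursive_fun_const recursive_fun_add recursive_fun_var assms)
qed

lemma recursive_pred_all:
  assumes "recursive_pred (\<lambda>e. P (e 0) (\<lambda>i. e (Suc i)))" and "recursive_fun b"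
  shows "recursive_pred (\<lambda>e. \<forall>i<b e. P i e)"
  using recursive_pred_not[OF recursive_pred_ex[OF recursive_pred_not[OF assms(1)] assms(2)]]
  by simp

text \<open>Digit \<open>m\<close> of \<open>D\<close> in binary is 1. Written with bounded
  quantifiers, this is recursive without any treatment of division.\<close>

lemma set_decode_iff: "m \<in> set_decode D \<longleftrightarrow> (\<exists>q<Suc D. \<exists>r<2 ^ m. D = (2 * q + 1) * 2 ^ m + r)"
proof
  assume "m \<in> set_decode D"
  then have "odd (D div 2 ^ m)" by (simp add: set_decode_def)
  then obtain q where q: "D div 2 ^ m = 2 * q + 1" by (elim oddE)
  have "D = (2 * q + 1) * 2 ^ m + D mod 2 ^ m"
    using q by (metis div_mult_mod_eq)
  moreover have "q < Suc D" using q div_le_dividend[of D "2 ^ m"] by linarith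
  ultimately show "\<exists>q<Suc D. \<exists>r<2 ^ m. D = (2 * q + 1) * 2 ^ m + r"
    by (metis mod_less_divisor zero_less_numeral zero_less_power)
next
  assume "\<exists>q<Suc D. \<exists>r<2 ^ m. D = (2 * q + 1) * 2 ^ m + r"
  then obtain q r where "r < 2 ^ m" "D = (2 * q + 1) * 2 ^ m + r" by blast
  then have "D div 2 ^ m = 2 * q + 1" by (metis add.right_neutral div_less div_mult_self3
        less_nat_zero_code mult.commute power_eq_0_iff zero_neq_numeral)
  then show "m \<in> set_decode D" by (simp add: set_decode_def)
qed

lemma recursive_pred_set_decode:
  assumes "recursive_fun a" and "recursive_fun b"
  shows "recursive_pred (\<lambda>e. a e \<in> set_decode (b e))"
proof -
  have "recursive_pred (\<lambda>e. e 0 \<in> set_decode (e 1))"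
    unfolding set_decode_iff
    by (intro recursive_pred_ex recursive_pred_eq recursive_fun_add recursive_fun_mult recursive_fun_power recursive_fun_Suc
        recursive_fun_var recursive_fun_const)
  then show ?thesis
    unfolding recursive_pred_def
    by (rule recursive_fun_comp2[where f = "\<lambda>m D. of_bool (m \<in> set_decode D)"]) (fact assms)+
qed

lemmas recursive_intros =
  recursive_pred_ex recursive_pred_all recursive_pred_conj recursive_pred_disj recursive_pred_imp recursive_pred_not
  recursive_pred_eq recursive_pred_less recursive_pred_le recursive_pred_set_decode
  recursive_fun_prod_encode recursive_fun_add recursive_fun_mult recursive_fun_power recursive_fun_diff recursive_fun_Suc
  recursive_fun_var recursive_fun_const

section \<open>Decidable and recursively enumerable sets\<close>

text \<open>The threshold may exceed 1, so the single argument is copied to fill all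
  \<open>N\<close> variables.\<close>

lemma recursive_fun_unary:
  assumes "recursive_fun (\<lambda>e. g (e 0))"
  obtains f where "\<And>n. computes f [n] (g n)"
proof -
  obtain p N where p: "\<And>n e. n \<ge> N \<Longrightarrow> computes p (map e [0..<n]) (g (e 0))"
    using assms unfolding recursive_fun_def by blast
  have "computes (Comp p (replicate N (Proj 0))) [n] (g n)" for n
  proof (rule computes.Comp)
    show "computes p (map (\<lambda>_. n) [0..<N]) (g n)"
      using p[of N "\<lambda>_. n"] by simp
    show "list_all2 (\<lambda>h y. computes h [n] y) (replicate N (Proj 0)) (map (\<lambda>_. n) [0..<N])"
      using computes.Proj[of 0 "[n]"] by (auto simp: list_all2_conv_all_nth)
  qed
  then show thesis by (rule that)
qed

lemma decidable_set_Collect: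
  assumes "recursive_pred (\<lambda>e. P (e 0))"
  shows "decidable_set {n. P n}"
  using assms unfolding recursive_pred_def
  by (rule recursive_fun_unary) (unfold decidable_set_def of_bool_def mem_Collect_eq, blast)

lemma recursive_pred_decidable_set:
  assumes "decidable_set D" and "recursive_fun a"
  shows "recursive_pred (\<lambda>e. a e \<in> D)"
proof -
  obtain f where f: "\<And>n. computes f [n] (of_bool (n \<in> D))"
    using assms(1) unfolding decidable_set_def of_bool_def by blast
  have "computes (Comp f [Proj 0]) (map e [0..<n]) (of_bool (e 0 \<in> D))" if "1 \<le> n" for n e
    by (rule computes.Comp[where ys = "[e 0]"])
      (use f computes.Proj[of 0 "map e [0..<n]"] that in auto)
  then have "recursive_fun (\<lambda>e. of_bool (e 0 \<in> D))"
    unfolding recursive_fun_def by blast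
  then show ?thesis
    unfolding recursive_pred_def using assms(2)
    by (rule recursive_fun_comp1[where f = "\<lambda>n. of_bool (n \<in> D)"])
qed

text \<open>An unbounded search for \<open>t\<close> by \<open>Mu\<close> halts exactly on the
  members. \<open>Mu\<close> looks for a zero, hence the negated predicate.\<close>

lemma rec_enumerable_Collect_ex:
  assumes "recursive_pred (\<lambda>e. P (e 0) (e 1))"
  shows "rec_enumerable {n. \<exists>t. P t n}"
proof -
  have "recursive_pred (\<lambda>e. \<not> P (e 0) (e 1))" by (rule recursive_pred_not[OF assms])
  then obtain p N where p: "\<And>n e. n \<ge> N \<Longrightarrow> computes p (map e [0..<n]) (of_bool (\<not> P (e 0) (e 1)))"
    unfolding recursive_pred_def recursive_fun_def by blast
  \<comment> \<open>The search variable comes first, and \<open>n\<close> fills every other place up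
    to the threshold.\<close>
  define q where "q = Comp p (Proj 0 # replicate N (Proj 1))"
  have q: "computes q [t, n] (of_bool (\<not> P t n))" for t n
    unfolding q_def
  proof (rule computes.Comp)
    have eq: "t # map (\<lambda>_. n) [0..<N] = map (case_nat t (\<lambda>_. n)) [0..<Suc N]"
      by (simp add: map_upt_Suc del: upt_Suc)
    show "computes p (t # map (\<lambda>_. n) [0..<N]) (of_bool (\<not> P t n))"
      unfolding eq using p[of "Suc N" "case_nat t (\<lambda>_. n)"] by simp
    show "list_all2 (\<lambda>h y. computes h [t, n] y) (Proj 0 # replicate N (Proj 1))
        (t # map (\<lambda>_. n) [0..<N])"
      using computes.Proj[of 0 "[t, n]"] computes.Proj[of 1 "[t, n]"]
      by (auto simp: list_all2_conv_all_nth nth_Cons split: nat.split)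
  qed
  have "(\<exists>t. P t n) \<longleftrightarrow> (\<exists>y. computes (Mu q) [n] y)" for n
  proof
    assume ex: "\<exists>t. P t n"
    have "computes (Mu q) [n] (LEAST t. P t n)"
    proof (rule computes.Mu)
      show "computes q [LEAST t. P t n, n] 0"
        using q[of "LEAST t. P t n" n] LeastI_ex[OF ex] by simp
      show "\<exists>k. computes q [m, n] (Suc k)" if "m < (LEAST t. P t n)" for m
        using q[of m n] not_less_Least[OF that] by auto
    qed
    then show "\<exists>y. computes (Mu q) [n] y" ..
  next
    assume "\<exists>y. computes (Mu q) [n] y"
    then obtain y where "computes q [y, n] 0"
      by (auto elim: computes.cases)
    with q[of y n] have "of_bool (\<not> P y n) = (0::nat)" by (rule computes_functional)
    then show "\<exists>t. P t n" by (auto split: if_splits)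
  qed
  then show ?thesis unfolding rec_enumerable_def by blast
qed

section \<open>A recursively enumerable undecidable set\<close>

fun recf_code :: "recf \<Rightarrow> nat" where
  "recf_code Zero = prod_encode (0, 0)"
| "recf_code Succ = prod_encode (1, 0)"
| "recf_code (Proj i) = prod_encode (2, i)"
| "recf_code (Comp f gs) = prod_encode (3, prod_encode (recf_code f, list_encode (map recf_code gs)))"
| "recf_code (PrimRec f g) = prod_encode (4, prod_encode (recf_code f, recf_code g))"
| "recf_code (Mu f) = prod_encode (5, recf_code f)"

text \<open>
  \<open>R e x y\<close> is read as the judgement ``the program coded by \<open>e\<close> maps the list coded by \<open>x\<close> to \<open>y\<close>'';
  the tag 6 is for the simultaneous evaluation of a list of programs to a list of values.
  Every premise of a step has a smaller program or the same program with a smaller recursion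
  variable, so that a set of judgements all of which are justified is sound, even though no order
  of derivation is recorded.
\<close>

definition justified :: "nat \<Rightarrow> (nat \<Rightarrow> nat \<Rightarrow> nat \<Rightarrow> bool) \<Rightarrow> nat \<Rightarrow> nat \<Rightarrow> nat \<Rightarrow> bool" where
  "justified b R e x y \<longleftrightarrow>
     e = prod_encode (0, 0) \<and> y = 0
   \<or> (\<exists>a<b. \<exists>t<b. e = prod_encode (1, 0) \<and> x = Suc (prod_encode (a, t)) \<and> y = Suc a)
   \<or> (\<exists>a<b. \<exists>t<b. e = prod_encode (2, 0) \<and> x = Suc (prod_encode (a, t)) \<and> y = a)
   \<or> (\<exists>a<b. \<exists>t<b. \<exists>i<b. e = prod_encode (2, Suc i) \<and> x = Suc (prod_encode (a, t))
        \<and> R (prod_encode (2, i)) t y)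
   \<or> (\<exists>f<b. \<exists>gs<b. \<exists>ys<b. e = prod_encode (3, prod_encode (f, gs))
        \<and> R (prod_encode (6, gs)) x ys \<and> R f ys y)
   \<or> e = prod_encode (6, 0) \<and> y = 0
   \<or> (\<exists>g<b. \<exists>gs<b. \<exists>z<b. \<exists>ys<b. e = prod_encode (6, Suc (prod_encode (g, gs)))
        \<and> y = Suc (prod_encode (z, ys)) \<and> R g x z \<and> R (prod_encode (6, gs)) x ys)
   \<or> (\<exists>f<b. \<exists>g<b. \<exists>t<b. e = prod_encode (4, prod_encode (f, g))
        \<and> x = Suc (prod_encode (0, t)) \<and> R f t y)
   \<or> (\<exists>f<b. \<exists>g<b. \<exists>t<b. \<exists>n<b. \<exists>z<b. e = prod_encode (4, prod_encode (f, g))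
        \<and> x = Suc (prod_encode (Suc n, t)) \<and> R e (Suc (prod_encode (n, t))) z
        \<and> R g (Suc (prod_encode (n, Suc (prod_encode (z, t))))) y)
   \<or> (\<exists>f<b. e = prod_encode (5, f) \<and> R f (Suc (prod_encode (y, x))) 0
        \<and> (\<forall>m<y. \<exists>k<b. R f (Suc (prod_encode (m, x))) (Suc k)))"

text \<open>All judgements used as premises occur positively, so derivations survive being merged
  into larger ones.\<close>

lemma justified_mono:
  assumes "justified b R e x y" and "b \<le> b'" and "\<And>e x y. R e x y \<Longrightarrow> R' e x y"
  shows "justified b' R' e x y"
proof -
  have "justified b R e x y \<longrightarrow> justified b' R' e x y"
    unfolding justified_def
    by (intro disj_mono conj_mono ex_mono all_mono imp_mono impI) (use assms(2,3) in auto)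
  with assms(1) show ?thesis by blast
qed

definition judgement :: "nat \<Rightarrow> nat \<Rightarrow> nat \<Rightarrow> nat \<Rightarrow> bool" where
  "judgement D e x y \<longleftrightarrow> prod_encode (e, prod_encode (x, y)) \<in> set_decode D"

text \<open>\<open>b\<close> bounds the witnesses in \<open>justified\<close>, which makes the
  notion recursive. Restricting the components to values below \<open>D\<close> loses nothing, by
  \<open>judgement_less\<close>.\<close>

definition derivation :: "nat \<Rightarrow> nat \<Rightarrow> bool" where
  "derivation b D \<longleftrightarrow> (\<forall>e<D. \<forall>x<D. \<forall>y<D. judgement D e x y \<longrightarrow> justified b (judgement D) e x y)"

lemma set_decode_less: "m \<in> set_decode D \<Longrightarrow> m < D"
proof -
  assume "m \<in> set_decode D"
  then have "2 ^ m \<le> D"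
    by (auto simp: set_decode_iff)
  then show "m < D"
    using less_exp[of m] by linarith
qed

lemma judgement_less:
  assumes "judgement D e x y"
  shows "e < D" "x < D" "y < D"
proof -
  have "prod_encode (e, prod_encode (x, y)) < D"
    using assms set_decode_less unfolding judgement_def by blast
  then show "e < D" "x < D" "y < D"
    by (meson le_prod_encode_1 le_prod_encode_2 le_less_trans)+
qed

lemma derivation_justified:
  assumes "derivation b D" and "judgement D e x y"
  shows "justified b (judgement D) e x y"
  using assms judgement_less unfolding derivation_def by blast

lemma Suc_prod_encode_list:
  "Suc (prod_encode (a, t)) = list_encode xs \<longleftrightarrow> (\<exists>ys. xs = a # ys \<and> t = list_encode ys)"
  "list_encode xs = Suc (prod_encode (a, t)) \<longleftrightarrow> (\<exists>ys. xs = a # ys \<and> t = list_encode ys)"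
  by (cases xs; force)+

text \<open>Structural induction on the program takes the place of induction on a derivation. Inner
  inductions handle the index of a projection, the list of programs in a composition and the
  recursion argument.\<close>

lemma derivation_sound:
  assumes D: "derivation b D" and "judgement D (recf_code f) (list_encode xs) y"
  shows "computes f xs y"
  using assms(2)
proof (induction f arbitrary: xs y)
  case Zero
  with derivation_justified[OF D Zero] show ?case
    by (auto simp: justified_def intro: computes.Zero)
next
  case Succ
  with derivation_justified[OF D Succ] show ?case
    by (auto simp: justified_def Suc_prod_encode_list intro: computes.Succ)
next
  case (Proj i)
  then show ?case
  proof (induction i arbitrary: xs)
    case 0
    with derivation_justified[OF D 0] show ?case
      using computes.Proj[of 0 xs] by (auto simp: justified_def Suc_prod_encode_list)
  next
    case (Suc i)
    with derivation_justified[OF D Suc.prems] obtain a ys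
      where xs: "xs = a # ys" and "judgement D (prod_encode (2, i)) (list_encode ys) y"
      by (auto simp: justified_def Suc_prod_encode_list)
    then have "computes (Proj i) ys y" using Suc.IH by simp
    then show ?case
      using computes.Proj[of "Suc i" xs] by (cases rule: computes.cases) (auto simp: xs)
  qed
next
  case (Comp f gs)
  from derivation_justified[OF D Comp.prems] obtain zs
    where zs: "judgement D (prod_encode (6, list_encode (map recf_code gs))) (list_encode xs) zs"
      and f: "judgement D (recf_code f) zs y"
    by (auto simp: justified_def)
  have "list_all2 (\<lambda>g y. computes g xs y) gs (list_decode zs)"
    using zs Comp.IH(2)
  proof (induction gs arbitrary: zs)
    case Nil
    with derivation_justified[OF D Nil(1)] show ?case
      by (auto simp: justified_def)
  next
    case (Cons g gs)
    from derivation_justified[OF D Cons.prems(1)] obtain z zs'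
      where zs: "zs = Suc (prod_encode (z, zs'))" and z: "judgement D (recf_code g) (list_encode xs) z"
        and zs': "judgement D (prod_encode (6, list_encode (map recf_code gs))) (list_encode xs) zs'"
      by (auto simp: justified_def)
    have "list_all2 (\<lambda>g y. computes g xs y) gs (list_decode zs')"
      by (rule Cons.IH[OF zs']) (use Cons.prems(2) in auto)
    then show ?case
      using Cons.prems(2)[OF _ z] by (simp add: zs)
  qed
  moreover have "computes f (list_decode zs) y"
    by (rule Comp.IH(1)) (simp add: f)
  ultimately show ?case by (rule computes.Comp)
next
  case (PrimRec f g)
  from derivation_justified[OF D PrimRec.prems] obtain n ys where "xs = n # ys"
    by (auto simp: justified_def Suc_prod_encode_list)
  then show ?case
    using PrimRec.prems
  proof (induction n arbitrary: xs y)
    case 0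
    from derivation_justified[OF D 0(2)] have "judgement D (recf_code f) (list_encode ys) y"
      by (auto simp: justified_def 0(1))
    then show ?case
      using PrimRec.IH(1) by (simp add: 0(1) computes.PrimRec_0)
  next
    case (Suc n)
    from derivation_justified[OF D Suc.prems(2)] obtain z
      where z: "judgement D (recf_code (PrimRec f g)) (list_encode (n # ys)) z"
        and y: "judgement D (recf_code g) (list_encode (n # z # ys)) y"
      by (auto simp: justified_def Suc.prems(1))
    show ?case
      unfolding Suc.prems(1)
      by (rule computes.PrimRec_Suc[OF Suc.IH[OF refl z] PrimRec.IH(2)[OF y]])
  qed
next
  case (Mu f)
  from derivation_justified[OF D Mu.prems]
  have 0: "judgement D (recf_code f) (list_encode (y # xs)) 0"
    and Suc: "\<And>m. m < y \<Longrightarrow> \<exists>k. judgement D (recf_code f) (list_encode (m # xs)) (Suc k)"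
    by (auto simp: justified_def)
  show ?case
    by (rule computes.Mu) (use Mu.IH 0 Suc in blast)+
qed

section \<open>Completeness of derivations\<close>

definition provable :: "nat \<Rightarrow> nat \<Rightarrow> nat \<Rightarrow> bool" where
  "provable e x y \<longleftrightarrow> (\<exists>b D. derivation b D \<and> judgement D e x y)"

text \<open>The derivations of the finitely many premises are united, the conclusion is added, and
  the bounds are summed; monotonicity keeps every old judgement justified.\<close>

lemma provableI:
  assumes S: "finite S" "\<And>e x y. (e, x, y) \<in> S \<Longrightarrow> provable e x y"
    and just: "justified b (\<lambda>e x y. (e, x, y) \<in> S) e x y"
  shows "provable e x y"
proof -
  have "\<exists>b D. derivation b D \<and> judgement D (fst s) (fst (snd s)) (snd (snd s))" if "s \<in> S" for s
    using S(2)[of "fst s" "fst (snd s)" "snd (snd s)"] that unfolding provable_def by simp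
  then obtain B C where BC': "\<And>s. s \<in> S \<Longrightarrow>
      derivation (B s) (C s) \<and> judgement (C s) (fst s) (fst (snd s)) (snd (snd s))"
    by metis
  have BC: "\<And>s. s \<in> S \<Longrightarrow> derivation (B s) (C s)"
    "\<And>e x y. (e, x, y) \<in> S \<Longrightarrow> judgement (C (e, x, y)) e x y"
    using BC' by fastforce+
  define U where "U = insert (prod_encode (e, prod_encode (x, y))) (\<Union>s\<in>S. set_decode (C s))"
  define D where "D = set_encode U"
  have "finite U" using S(1) by (auto simp: U_def)
  then have decode: "set_decode D = U" by (simp add: D_def)
  define b' where "b' = b + (\<Sum>s\<in>S. B s)"
  have b': "b \<le> b'" "\<And>s. s \<in> S \<Longrightarrow> B s \<le> b'"
    using S(1) member_le_sum[of _ S B] by (auto simp: b'_def trans_le_add2)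
  have C: "judgement (C s) e x y \<Longrightarrow> judgement D e x y" if "s \<in> S" for s e x y
    using that unfolding judgement_def decode U_def by blast
  have "justified b' (judgement D) e' x' y'" if "judgement D e' x' y'" for e' x' y'
  proof (cases "\<exists>s\<in>S. judgement (C s) e' x' y'")
    case True
    then obtain s where s: "s \<in> S" "judgement (C s) e' x' y'" by blast
    show ?thesis
      using derivation_justified[OF BC(1)[OF s(1)] s(2)] b'(2)[OF s(1)] C[OF s(1)]
      by (rule justified_mono)
  next
    case False
    \<comment> \<open>A judgement in the union that belongs to none of the given derivations is the
      added conclusion.\<close>
    then have "(e', x', y') = (e, x, y)"
      using that unfolding judgement_def decode U_def by auto
    then show ?thesis
      using justified_mono[OF just b'(1)] BC(2) C by auto
  qed
  then have "derivation b' D" by (simp add: derivation_def)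
  moreover have "judgement D e x y" by (simp add: judgement_def decode U_def)
  ultimately show ?thesis unfolding provable_def by blast
qed

lemma justified_Comp:
  assumes "f < b" "gs < b" "ys < b" "R (prod_encode (6, gs)) x ys" "R f ys y"
  shows "justified b R (prod_encode (3, prod_encode (f, gs))) x y"
  using assms by (simp add: justified_def) blast

lemma justified_PrimRec_Suc:
  assumes "f < b" "g < b" "t < b" "n < b" "z < b"
    and "R (prod_encode (4, prod_encode (f, g))) (Suc (prod_encode (n, t))) z"
    and "R g (Suc (prod_encode (n, Suc (prod_encode (z, t))))) y"
  shows "justified b R (prod_encode (4, prod_encode (f, g))) (Suc (prod_encode (Suc n, t))) y"
  using assms by (simp add: justified_def) blast

lemma justified_Mu:
  assumes "f < b" and "R f (Suc (prod_encode (y, x))) 0"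
    and "\<And>m. m < y \<Longrightarrow> \<exists>k<b. R f (Suc (prod_encode (m, x))) (Suc k)"
  shows "justified b R (prod_encode (5, f)) x y"
  using assms by (simp add: justified_def)

text \<open>Each rule of \<open>computes\<close> becomes an application of \<open>provableI\<close>
  to its premises, with a bound above all witnesses that \<open>justified\<close> asks for. A
  composition first gets its judgement of tag 6, built along the list of programs.\<close>

lemma computes_provable:
  "computes f xs y \<Longrightarrow> provable (recf_code f) (list_encode xs) y"
proof (induction rule: computes.induct)
  case (Zero xs)
  show ?case by (rule provableI[of "{}"]) (auto simp: justified_def)
next
  case (Succ x xs)
  show ?case
    by (rule provableI[of "{}" "Suc (x + list_encode xs)"]) (auto simp: justified_def)
next
  case (Proj i xs)
  then show ?case
  proof (induction i arbitrary: xs)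
    case 0
    then obtain a ys where xs: "xs = a # ys" by (cases xs) auto
    show ?case
      by (rule provableI[of "{}" "Suc (a + list_encode ys)"]) (auto simp: justified_def xs)
  next
    case (Suc i)
    then obtain a ys where xs: "xs = a # ys" by (cases xs) auto
    show ?case
      by (rule provableI[of "{(prod_encode (2, i), list_encode ys, xs ! Suc i)}" "Suc (i + a + list_encode ys)"])
        (use Suc.IH[of ys] Suc.prems in \<open>auto simp: justified_def xs\<close>)
  qed
next
  case (Comp xs gs ys f z)
  have "provable (prod_encode (6, list_encode (map recf_code gs))) (list_encode xs) (list_encode ys)"
    using Comp.IH(1)
  proof (induction rule: list_all2_induct)
    case Nil
    show ?case by (rule provableI[of "{}"]) (auto simp: justified_def)
  next
    case (Cons g gs y ys)
    show ?case
      by (rule provableI[of "{(recf_code g, list_encode xs, y),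
            (prod_encode (6, list_encode (map recf_code gs)), list_encode xs, list_encode ys)}"
            "Suc (recf_code g + list_encode (map recf_code gs) + y + list_encode ys)"])
        (use Cons in \<open>auto simp: justified_def\<close>)
  qed
  with Comp.IH(2) show ?case
    unfolding recf_code.simps
    by (intro provableI[of "{(prod_encode (6, list_encode (map recf_code gs)), list_encode xs, list_encode ys),
            (recf_code f, list_encode ys, z)}", OF _ _
          justified_Comp[where ys = "list_encode ys" and b = "Suc (recf_code f + list_encode (map recf_code gs) + list_encode ys)"]])
      auto
next
  case (PrimRec_0 f xs y g)
  then show ?case
    by (rule_tac provableI[of "{(recf_code f, list_encode xs, y)}"
            "Suc (recf_code f + recf_code g + list_encode xs)"])
      (auto simp: justified_def)
next
  case (PrimRec_Suc f g n xs y z)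
  then show ?case
    unfolding recf_code.simps list_encode.simps
    by (intro provableI[of "{(recf_code (PrimRec f g), list_encode (n # xs), y),
            (recf_code g, list_encode (n # y # xs), z)}", OF _ _
          justified_PrimRec_Suc[where z = y and
            b = "Suc (recf_code f + recf_code g + list_encode xs + n + y)"]])
      auto
next
  case (Mu f n xs)
  \<comment> \<open>The values at arguments below \<open>n\<close> are the \<open>Suc (k m)\<close>;
    the sum of the \<open>k m\<close> bounds the witnesses in the search clause.\<close>
  then obtain k where k: "\<And>m. m < n \<Longrightarrow> provable (recf_code f) (list_encode (m # xs)) (Suc (k m))"
    by metis
  have le: "k m < Suc (recf_code f + sum k {..<n})" if "m < n" for m
    using member_le_sum[of m "{..<n}" k] that by auto
  let ?S = "insert (recf_code f, list_encode (n # xs), 0)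
    ((\<lambda>m. (recf_code f, list_encode (m # xs), Suc (k m))) ` {..<n})"
  have just: "justified (Suc (recf_code f + sum k {..<n})) (\<lambda>e x y. (e, x, y) \<in> ?S)
      (prod_encode (5, recf_code f)) (list_encode xs) n"
  proof (rule justified_Mu)
    show "\<exists>j<Suc (recf_code f + sum k {..<n}).
        (recf_code f, Suc (prod_encode (m, list_encode xs)), Suc j) \<in> ?S" if "m < n" for m
      by (intro exI[of _ "k m"] conjI le[OF that]) (use that in simp)
  qed simp_all
  have prems: "provable e x y" if "(e, x, y) \<in> ?S" for e x y
    using that Mu.IH(1) k by blast
  have "finite ?S" by simp
  then show ?case
    unfolding recf_code.simps by (rule provableI[OF _ prems just])
qed

section \<open>The diagonal set\<close>

text \<open>\<open>Suc (prod_encode (e, 0))\<close> is the code of the list \<open>[e]\<close>: the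
  program with code \<open>e\<close> is run on its own code and has to return 0. The single number
  \<open>t\<close> bounds both the derivation and its witnesses.\<close>

definition halts :: "nat \<Rightarrow> nat \<Rightarrow> bool" where
  "halts t e \<longleftrightarrow> (\<exists>b<t. \<exists>D<t. derivation b D \<and> judgement D e (Suc (prod_encode (e, 0))) 0)"

definition halting_set :: "nat set" where
  "halting_set = {e. \<exists>t. halts t e}"

lemma recf_code_in_halting_set: "recf_code f \<in> halting_set \<longleftrightarrow> computes f [recf_code f] 0"
proof -
  let ?e = "recf_code f"
  have "halts (Suc (b + D)) ?e" if "derivation b D" "judgement D ?e (list_encode [?e]) 0" for b D
    using that less_add_Suc1[of b D] less_add_Suc2[of D b] unfolding halts_def list_encode.simps
    by blast
  then have "?e \<in> halting_set \<longleftrightarrow> provable ?e (list_encode [?e]) 0"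
    unfolding halting_set_def provable_def halts_def list_encode.simps by blast
  also have "\<dots> \<longleftrightarrow> computes f [?e] 0"
    using computes_provable derivation_sound unfolding provable_def by blast
  finally show ?thesis .
qed

text \<open>A decider applied to its own code would return 1 if it returns 0 there, and 0 if it does
  not.\<close>

lemma halting_set_undecidable: "\<not> decidable_set halting_set"
proof
  assume "decidable_set halting_set"
  then obtain f where f: "\<And>n. computes f [n] (if n \<in> halting_set then 1 else 0)"
    unfolding decidable_set_def by blast
  show False
  proof (cases "recf_code f \<in> halting_set")
    case True
    then have "computes f [recf_code f] 1" and "computes f [recf_code f] 0"
      using f[of "recf_code f"] by (simp_all add: recf_code_in_halting_set)
    from computes_functional[OF this] show False by simp
  next
    case False
    then show False
      using f[of "recf_code f"] by (simp add: recf_code_in_halting_set)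
  qed
qed

lemma recursive_pred_halts: "recursive_pred (\<lambda>e. halts (e 0) (e 1))"
  unfolding halts_def derivation_def justified_def judgement_def
  by (intro recursive_intros)

section \<open>The subshift\<close>

lemma appears_iff: "appears p x \<longleftrightarrow> (\<exists>u. \<forall>v b. p v = Some b \<longrightarrow> x (v + u) = b)"
proof -
  have "(Some \<circ> shift u x) |` dom p = p \<longleftrightarrow> (\<forall>v b. p v = Some b \<longrightarrow> x (v + u) = b)" for u
  proof
    assume eq: "(Some \<circ> shift u x) |` dom p = p"
    show "\<forall>v b. p v = Some b \<longrightarrow> x (v + u) = b"
    proof (intro allI impI)
      fix v b assume "p v = Some b"
      then show "x (v + u) = b"
        using fun_cong[OF eq, of v] by (auto simp: restrict_map_def shift_def dom_def)
    qed
  next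
    assume "\<forall>v b. p v = Some b \<longrightarrow> x (v + u) = b"
    then show "(Some \<circ> shift u x) |` dom p = p"
      by (auto simp: restrict_map_def shift_def dom_def fun_eq_iff)
  qed
  then show ?thesis unfolding appears_def by simp
qed

lemma shift_in_avoiding:
  assumes "x \<in> avoiding A F"
  shows "shift u x \<in> avoiding A F"
proof -
  have "appears p x" if "appears p (shift u x)" for p
    using that unfolding appears_iff shift_def by (metis add.assoc)
  then show ?thesis
    using assms by (auto simp: avoiding_def shift_def)
qed

section \<open>Configurations with at most two ones\<close>

definition pair :: "nat \<Rightarrow> pattern" where
  "pair n = [0 \<mapsto> 1, int n \<mapsto> 1]"

text \<open>The code of the two-element graph as a sum of two powers of 2; \<open>int_encode\<close>
  sends \<open>int n\<close> to \<open>2 * n\<close>. For \<open>n = 0\<close> the two entries would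
  coincide, which explains the assumption of \<open>pattern_code_pair\<close>.\<close>

definition pair_code :: "nat \<Rightarrow> nat" where
  "pair_code n = 2 ^ prod_encode (0, 1) + 2 ^ prod_encode (2 * n, 1)"

lemma pattern_code_pair:
  assumes "0 < n"
  shows "pattern_code (pair n) = pair_code n"
proof -
  have "Map.graph (pair n) = {(0, 1), (int n, 1)}"
    using assms by (auto simp: pair_def Map.graph_def split: if_splits)
  then show ?thesis
    using assms
    by (simp add: pattern_code_def pair_code_def int_encode_def sum_encode_def)
qed

lemma pair_in_patterns: "pair n \<in> patterns {0, 1}"
  by (auto simp: pair_def patterns_def ran_def split: if_splits)

lemma appears_pair: "appears (pair n) x \<longleftrightarrow> (\<exists>i. x i = 1 \<and> x (i + int n) = 1)"
proof
  assume "appears (pair n) x"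
  then obtain u where u: "\<And>v b. pair n v = Some b \<Longrightarrow> x (v + u) = b"
    by (auto simp: appears_iff)
  have "x u = 1 \<and> x (u + int n) = 1"
    using u[of 0 1] u[of "int n" 1] by (simp add: pair_def add.commute)
  then show "\<exists>i. x i = 1 \<and> x (i + int n) = 1" ..
next
  assume "\<exists>i. x i = 1 \<and> x (i + int n) = 1"
  then obtain i where "x i = 1" "x (i + int n) = 1" by blast
  then show "appears (pair n) x"
    unfolding appears_iff by (intro exI[of _ i]) (auto simp: pair_def add.commute split: if_splits)
qed

text \<open>Forbidding the even distances makes three ones impossible.\<close>

definition bad_distances :: "nat set" where
  "bad_distances = {n. 0 < n \<and> (\<exists>m. n = 2 * m \<or> n = Suc (2 * m) \<and> m \<in> halting_set)}"

definition halting_subshift :: "config set" where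
  "halting_subshift = avoiding {0, 1} (pair ` bad_distances)"

definition ones :: "int set \<Rightarrow> config" where
  "ones S = (\<lambda>v. of_bool (v \<in> S))"

lemma ones_eq_1 [simp]: "ones S v = 1 \<longleftrightarrow> v \<in> S" "ones S v = Suc 0 \<longleftrightarrow> v \<in> S"
  by (simp_all add: ones_def)

lemma ones_eq_iff: "ones S = ones T \<longleftrightarrow> S = T"
  by (auto simp: ones_def fun_eq_iff)

lemma odd_in_bad_distances: "Suc (2 * m) \<in> bad_distances \<longleftrightarrow> m \<in> halting_set"
proof -
  have "Suc (2 * m) \<noteq> 2 * k" for k by presburger
  then show ?thesis by (auto simp: bad_distances_def)
qed

lemma halting_subshift_iff:
  "x \<in> halting_subshift \<longleftrightarrow>
     range x \<subseteq> {0, 1} \<and> (\<forall>n\<in>bad_distances. \<forall>i. \<not> (x i = 1 \<and> x (i + int n) = 1))"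
  unfolding halting_subshift_def avoiding_def using appears_pair by auto

lemma halting_subshift_ones:
  "x \<in> halting_subshift \<Longrightarrow> x = ones {v. x v = 1}"
  unfolding halting_subshift_iff by (force simp: ones_def fun_eq_iff)

lemma singleton_in_halting_subshift: "ones {i} \<in> halting_subshift"
  by (auto simp: halting_subshift_iff bad_distances_def) (auto simp: ones_def)

lemma empty_in_halting_subshift: "ones {} \<in> halting_subshift"
  by (auto simp: halting_subshift_iff bad_distances_def) (auto simp: ones_def)

lemma pair_in_halting_subshift:
  assumes "n \<notin> bad_distances"
  shows "ones {i, i + int n} \<in> halting_subshift"
proof -
  have "range (ones {i, i + int n}) \<subseteq> {0, 1}" by (auto simp: ones_def)
  moreover have False if "k \<in> bad_distances" "j \<in> {i, i + int n}" "j + int k \<in> {i, i + int n}" for j k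
  proof -
    have "0 < k" using that(1) by (simp add: bad_distances_def)
    then have "k = n" using that(2,3) by auto
    then show False using assms that(1) by simp
  qed
  ultimately show ?thesis unfolding halting_subshift_iff ones_eq_1 by blast
qed

lemma odd_distance_in_halting_subshift:
  assumes "x \<in> halting_subshift" "x i = 1" "x j = 1" "i < j"
  shows "odd (j - i)"
proof
  assume "even (j - i)"
  then have "even (nat (j - i))" using assms(4) by (simp add: even_nat_iff)
  then have "nat (j - i) \<in> bad_distances"
    using assms(4) by (auto simp: bad_distances_def elim: evenE)
  then show False
    using assms unfolding halting_subshift_iff by fastforce
qed

lemma halting_subshift_cases:
  assumes "x \<in> halting_subshift"
  obtains (empty) "x = ones {}" | (single) i where "x = ones {i}"
    | (pair) i n where "0 < n" "odd n" "x = ones {i, i + n}"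
proof -
  define S where "S = {v. x v = 1}"
  have x: "x = ones S" unfolding S_def by (rule halting_subshift_ones[OF assms])
  have odd: "odd (j - i)" if "i \<in> S" "j \<in> S" "i \<noteq> j" for i j
    using odd_distance_in_halting_subshift[OF assms, of i j]
      odd_distance_in_halting_subshift[OF assms, of j i] that
    by (cases "i < j") (auto simp: S_def)
  consider "S = {}" | i where "S = {i}" | i j where "i \<in> S" "j \<in> S" "i < j"
    by (metis ex_in_conv insertI1 linorder_neqE singletonD subsetI subset_antisym
        empty_subsetI insert_subset)
  then show thesis
  proof cases
    case (3 i j)
    have "S = {i, j}"
    proof (rule ccontr)
      assume "S \<noteq> {i, j}"
      then obtain k where "k \<in> S" "k \<noteq> i" "k \<noteq> j" using 3 by blast
      \<comment> \<open>Among the differences of three integers, one is the sum of the other two, so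
        they cannot all be odd.\<close>
      then show False using odd[of i j] odd[of i k] odd[of j k] 3 by (auto; presburger)
    qed
    then show thesis using pair[of "j - i" i] odd[of i j] 3 x by auto
  qed (use empty single x in auto)
qed

section \<open>Effectiveness of the subshift\<close>

lemma recursive_fun_pair_code: "recursive_fun a \<Longrightarrow> recursive_fun (\<lambda>e. pair_code (a e))"
  unfolding pair_code_def by (intro recursive_intros)

lemma less_pair_code: "n < pair_code n"
proof -
  have "n \<le> prod_encode (2 * n, 1)" using le_prod_encode_1[of "2 * n" 1] by simp
  also have "\<dots> < 2 ^ prod_encode (2 * n, 1)" by (rule less_exp)
  finally show ?thesis by (simp add: pair_code_def)
qed

lemma effective_halting_subshift: "effective_subshift halting_subshift"
proof -
  \<comment> \<open>Only the search for the derivation bound \<open>t\<close> is unbounded;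
    \<open>n\<close> is bounded by its own pattern code through
    \<open>less_pair_code\<close>.\<close>
  have codes: "pattern_code ` pair ` bad_distances = {c. \<exists>t. \<exists>n<c. 0 < n \<and> c = pair_code n \<and>
      (\<exists>m<Suc n. n = 2 * m \<or> n = Suc (2 * m) \<and> halts t m)}" (is "_ = ?C")
  proof (intro equalityI subsetI)
    fix c assume "c \<in> pattern_code ` pair ` bad_distances"
    then obtain n where "n \<in> bad_distances" "c = pattern_code (pair n)" by blast
    then obtain m t where "0 < n" "c = pair_code n" "n = 2 * m \<or> n = Suc (2 * m) \<and> halts t m"
      unfolding bad_distances_def halting_set_def using pattern_code_pair by blast
    moreover from this(3) have "m < Suc n" by auto
    ultimately show "c \<in> ?C" using less_pair_code by blast
  next
    fix c assume "c \<in> ?C"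
    then obtain n m t where "0 < n" "c = pair_code n" "n = 2 * m \<or> n = Suc (2 * m) \<and> halts t m"
      by blast
    then have "n \<in> bad_distances" "c = pattern_code (pair n)"
      by (auto simp: bad_distances_def halting_set_def pattern_code_pair)
    then show "c \<in> pattern_code ` pair ` bad_distances" by blast
  qed
  have halts: "recursive_pred (\<lambda>e. halts (a e) (b e))" if "recursive_fun a" "recursive_fun b" for a b
    using recursive_pred_halts that unfolding recursive_pred_def
    by (rule recursive_fun_comp2[where f = "\<lambda>t m. of_bool (halts t m)"])
  have "rec_enumerable (pattern_code ` pair ` bad_distances)"
    unfolding codes
    by (rule rec_enumerable_Collect_ex) (intro recursive_intros halts recursive_fun_pair_code)
  then show ?thesis
    unfolding effective_subshift_def halting_subshift_def using pair_in_patterns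
    by (intro exI[of _ "{0, 1}"] exI[of _ "pair ` bad_distances"]) auto
qed

section \<open>Undecidability of the language and of inclusion\<close>

text \<open>A many-one reduction, from the halting set for \<open>b = True\<close> and from its
  complement for \<open>b = False\<close>.\<close>

lemma undecidable_by_halting_set:
  assumes "\<And>m. g m \<in> D \<longleftrightarrow> (m \<in> halting_set) = b" and "recursive_fun (\<lambda>e. g (e 0))"
  shows "\<not> decidable_set D"
proof
  assume D: "decidable_set D"
  have "recursive_pred (\<lambda>e. g (e 0) \<in> D)"
    by (rule recursive_pred_decidable_set[OF D assms(2)])
  moreover from recursive_pred_not[OF this] have "recursive_pred (\<lambda>e. g (e 0) \<notin> D)" .
  ultimately have "recursive_pred (\<lambda>e. e 0 \<in> halting_set)"
    using assms(1) by (cases b) simp_all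
  then show False
    using decidable_set_Collect[of "\<lambda>n. n \<in> halting_set"] halting_set_undecidable by simp
qed

lemma pair_in_language_iff:
  "pair n \<in> language halting_subshift \<longleftrightarrow> (\<exists>x\<in>halting_subshift. appears (pair n) x)"
  using pair_in_patterns[of n] by (simp add: language_def patterns_def)

lemma odd_pair_in_language: "pair (Suc (2 * m)) \<in> language halting_subshift \<longleftrightarrow> m \<notin> halting_set"
proof -
  let ?n = "Suc (2 * m)"
  have "pair ?n \<in> language halting_subshift \<longleftrightarrow> (\<exists>x\<in>halting_subshift. appears (pair ?n) x)"
    by (rule pair_in_language_iff)
  also have "\<dots> \<longleftrightarrow> ?n \<notin> bad_distances"
  proof
    assume "?n \<notin> bad_distances"
    then have "ones {0, 0 + int ?n} \<in> halting_subshift" by (rule pair_in_halting_subshift)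
    moreover have "appears (pair ?n) (ones {0, 0 + int ?n})"
      unfolding appears_pair by (intro exI[of _ 0]) simp
    ultimately show "\<exists>x\<in>halting_subshift. appears (pair ?n) x" by blast
  qed (auto simp: halting_subshift_def avoiding_def)
  finally show ?thesis by (simp add: odd_in_bad_distances)
qed

lemma language_not_computable: "\<not> computable_patterns (language halting_subshift)"
  unfolding computable_patterns_def
proof (rule undecidable_by_halting_set)
  fix m
  let ?p = "pair (Suc (2 * m))"
  have "pattern_code ?p \<in> pattern_code ` language halting_subshift \<longleftrightarrow> ?p \<in> language halting_subshift"
    by (rule inj_on_image_mem_iff[OF inj_on_pattern_code])
      (use pair_in_patterns[of "Suc (2 * m)"] in \<open>auto simp: patterns_def language_def\<close>)
  then show "pair_code (Suc (2 * m)) \<in> pattern_code ` language halting_subshift \<longleftrightarrow>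
      (m \<in> halting_set) = False"
    by (simp add: odd_pair_in_language pattern_code_pair)
next
  show "recursive_fun (\<lambda>e. pair_code (Suc (2 * e 0)))"
    by (intro recursive_fun_pair_code recursive_intros)
qed

text \<open>The SFT over \<open>{0, 1}\<close> whose only forbidden pattern is a pair of ones at
  distance \<open>2 * m + 1\<close> contains the subshift exactly when that pair is absent from the
  language, that is, when \<open>m\<close> is in the halting set.\<close>

lemma inclusion_undecidable: "\<not> decidable_for_sfts (\<lambda>X. halting_subshift \<subseteq> X)"
  unfolding decidable_for_sfts_def
proof (rule undecidable_by_halting_set)
  fix m
  let ?n = "Suc (2 * m)" and ?S = "{(A, F) \<in> sft_inputs. halting_subshift \<subseteq> avoiding A F}"
  have input: "({0, 1}, {pair ?n}) \<in> sft_inputs"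
    using pair_in_patterns by (simp add: sft_inputs_def)
  have code: "sft_code ({0, 1}, {pair ?n}) = prod_encode (set_encode {0, 1}, 2 ^ pair_code ?n)"
    by (simp add: sft_code_def pattern_code_pair del: set_encode_insert) (simp add: set_encode_def)
  have "sft_code ({0, 1}, {pair ?n}) \<in> sft_code ` ?S \<longleftrightarrow> ({0, 1}, {pair ?n}) \<in> ?S"
    by (rule inj_on_image_mem_iff[OF inj_on_sft_code input]) auto
  also have "\<dots> \<longleftrightarrow> halting_subshift \<subseteq> avoiding {0, 1} {pair ?n}"
    using input by simp
  also have "\<dots> \<longleftrightarrow> pair ?n \<notin> language halting_subshift"
    unfolding pair_in_language_iff by (auto simp: avoiding_def halting_subshift_def)
  finally show "prod_encode (set_encode {0, 1}, 2 ^ pair_code ?n) \<in> sft_code ` ?S \<longleftrightarrow>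
      (m \<in> halting_set) = True"
    unfolding code odd_pair_in_language by blast
next
  show "recursive_fun (\<lambda>e. prod_encode (set_encode {0, 1}, 2 ^ pair_code (Suc (2 * e 0))))"
    by (intro recursive_fun_pair_code recursive_intros)
qed

section \<open>Embeddings of the subshift\<close>

definition homoclinic :: "config \<Rightarrow> bool" where
  "homoclinic x \<longleftrightarrow> (\<exists>a. finite {v. x v \<noteq> a} \<and> (\<exists>v. x v \<noteq> a))"

section \<open>Continuity, and homoclinic points from embeddings\<close>

lemma continuous_on_local:
  fixes f :: "('a \<Rightarrow> 'b::discrete_topology) \<Rightarrow> 'c::topological_space"
  assumes "finite W" and "\<And>x y. x \<in> S \<Longrightarrow> y \<in> S \<Longrightarrow> (\<And>w. w \<in> W \<Longrightarrow> x w = y w) \<Longrightarrow> f x = f y"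
  shows "continuous_on S f"
  unfolding continuous_on_topological
proof (intro ballI allI impI)
  fix x B assume x: "x \<in> S" "open B" "f x \<in> B"
  let ?A = "\<Inter>w\<in>W. (\<lambda>y. y w) -` {x w}"
  have "open ((\<lambda>y. y w) -` {x w})" for w
    using open_vimage[OF open_discrete continuous_on_product_coordinates] .
  then have "open ?A"
    using assms(1) by (intro open_INT) auto
  moreover have "f y \<in> B" if "y \<in> S" "y \<in> ?A" for y
  proof -
    have "f x = f y" using x(1) that by (intro assms(2)) auto
    with x(3) show ?thesis by simp
  qed
  ultimately show "\<exists>A. open A \<and> x \<in> A \<and> (\<forall>y\<in>S. y \<in> A \<longrightarrow> f y \<in> B)"
    by (intro exI[of _ ?A]) auto
qed

text \<open>A basic open set of the product topology constrains finitely many coordinates, and these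
  form \<open>W\<close>. The window may depend on \<open>x\<close>; the application is at the single
  point \<open>ones {}\<close>.\<close>

lemma continuous_on_imp_local:
  fixes f :: "('a \<Rightarrow> 'b::discrete_topology) \<Rightarrow> 'c \<Rightarrow> 'd::discrete_topology"
  assumes "continuous_on S f" and "x \<in> S"
  shows "\<exists>W. finite W \<and> (\<forall>y\<in>S. (\<forall>w\<in>W. y w = x w) \<longrightarrow> f y c = f x c)"
proof -
  have "continuous_on S (\<lambda>y. f y c)"
    by (rule continuous_on_product_then_coordinatewise[OF assms(1)])
  then obtain A where A: "open A" "x \<in> A" "\<And>y. y \<in> S \<Longrightarrow> y \<in> A \<Longrightarrow> f y c = f x c"
    unfolding continuous_on_topological using assms(2) open_discrete[of "{f x c}"]
    by (metis singletonD singletonI)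
  obtain X where X: "x \<in> Pi\<^sub>E UNIV X" "finite {i. X i \<noteq> UNIV}" "Pi\<^sub>E UNIV X \<subseteq> A"
    using product_topology_open_contains_basis[of "\<lambda>_. euclidean" UNIV A x] A(1,2)
    by (auto simp: open_fun_def)
  have "y \<in> A" if "\<And>w. w \<in> {i. X i \<noteq> UNIV} \<Longrightarrow> y w = x w" for y
  proof -
    have "y i \<in> X i" for i
      using that[of i] X(1) by (cases "X i = UNIV") (auto simp: PiE_iff)
    then show ?thesis using X(3) by (auto simp: PiE_iff)
  qed
  then show ?thesis
    using X(2) A(3) by (intro exI[of _ "{i. X i \<noteq> UNIV}"] conjI ballI impI) auto
qed

text \<open>\<open>ones {}\<close> is shift-invariant, so its image is constant. By continuity
  there, the image of \<open>ones {0}\<close> agrees with that constant far from the one; by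
  injectivity it is not equal to it.\<close>

lemma homoclinic_if_embeds:
  assumes "halting_subshift \<hookrightarrow> X"
  shows "\<exists>x\<in>X. homoclinic x"
proof -
  obtain \<phi> where \<phi>: "\<phi> ` halting_subshift \<subseteq> X" "continuous_on halting_subshift \<phi>"
      "inj_on \<phi> halting_subshift"
      "\<And>u x. x \<in> halting_subshift \<Longrightarrow> \<phi> (shift u x) = shift u (\<phi> x)"
    using assms unfolding embeds_def by blast
  define x where "x = \<phi> (ones {0})"
  define a where "a = \<phi> (ones {}) 0"
  have "x \<in> X" unfolding x_def using \<phi>(1) singleton_in_halting_subshift by blast
  have shift_ones: "shift u (ones S) = ones ((\<lambda>v. v - u) ` S)" for u S
    by (force simp: shift_def ones_def fun_eq_iff)
  have const: "\<phi> (ones {}) = (\<lambda>_. a)"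
  proof
    fix v
    show "\<phi> (ones {}) v = a"
      using fun_cong[OF \<phi>(4)[OF empty_in_halting_subshift, of v], of 0]
      by (simp add: shift_ones a_def) (simp add: shift_def)
  qed
  obtain W where W: "finite W"
      "\<forall>y\<in>halting_subshift. (\<forall>w\<in>W. y w = ones {} w) \<longrightarrow> \<phi> y 0 = a"
    using continuous_on_imp_local[OF \<phi>(2) empty_in_halting_subshift, of 0] unfolding a_def by (elim exE conjE)
  \<comment> \<open>Shifting by \<open>v\<close> moves the one to \<open>- v\<close>, which is
    invisible through \<open>W\<close>.\<close>
  have "x v = a" if "v \<notin> uminus ` W" for v
  proof -
    have "x v = \<phi> (ones {- v}) 0"
      using fun_cong[OF \<phi>(4)[OF singleton_in_halting_subshift[of 0], of v], of 0]
      by (simp add: shift_ones x_def) (simp add: shift_def)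
    also have "\<dots> = a"
    proof (rule W(2)[rule_format, OF singleton_in_halting_subshift])
      fix w assume "w \<in> W"
      then have "w \<noteq> - v" using that by force
      then show "ones {- v} w = ones {} w" by (simp add: ones_def)
    qed
    finally show ?thesis .
  qed
  then have "{v. x v \<noteq> a} \<subseteq> uminus ` W" by blast
  then have "finite {v. x v \<noteq> a}" using W(1) finite_subset by blast
  moreover have "\<exists>v. x v \<noteq> a"
  proof (rule ccontr)
    assume "\<nexists>v. x v \<noteq> a"
    then have "\<phi> (ones {0}) = \<phi> (ones {})" unfolding const x_def by auto
    then have "ones {0} = ones {}"
      using inj_onD[OF \<phi>(3)] singleton_in_halting_subshift empty_in_halting_subshift by blast
    then show False by (simp add: ones_eq_iff)
  qed
  ultimately show ?thesis using \<open>x \<in> X\<close> unfolding homoclinic_def by blast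
qed

section \<open>Placing copies of a finite block\<close>

definition separated :: "int \<Rightarrow> int set \<Rightarrow> bool" where
  "separated d P \<longleftrightarrow> (\<forall>k\<in>P. \<forall>l\<in>P. k \<noteq> l \<longrightarrow> d \<le> \<bar>k - l\<bar>)"

text \<open>A copy of \<open>x\<close> on \<open>0..<N\<close> starts at each element of
  \<open>P\<close>, and \<open>a\<close> fills the rest. Once copies do not overlap,
  \<open>SOME\<close> chooses the only candidate.\<close>

definition place :: "nat \<Rightarrow> int \<Rightarrow> config \<Rightarrow> int set \<Rightarrow> config" where
  "place a N x P = (\<lambda>v. if \<exists>k. k \<in> P \<and> k \<le> v \<and> v < k + N
     then x (v - (SOME k. k \<in> P \<and> k \<le> v \<and> v < k + N)) else a)"

lemma place_in:
  assumes "separated N P" "k \<in> P" "k \<le> v" "v < k + N"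
  shows "place a N x P v = x (v - k)"
proof -
  have uniq: "l = k" if "l \<in> P \<and> l \<le> v \<and> v < l + N" for l
  proof (rule ccontr)
    assume "l \<noteq> k"
    with assms(1,2) that have "N \<le> \<bar>k - l\<bar>" by (simp add: separated_def)
    then show False using assms(3,4) that by linarith
  qed
  have k: "k \<in> P \<and> k \<le> v \<and> v < k + N" using assms by simp
  have "(SOME k. k \<in> P \<and> k \<le> v \<and> v < k + N) = k"
    using k uniq by (rule some_equality)
  moreover have "\<exists>k. k \<in> P \<and> k \<le> v \<and> v < k + N" using k by (rule exI)
  ultimately show ?thesis by (simp only: place_def if_True)
qed

lemma place_out:
  assumes "\<And>k. k \<in> P \<Longrightarrow> k \<le> v \<Longrightarrow> v < k + N \<Longrightarrow> False"
  shows "place a N x P v = a"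
  using assms unfolding place_def by auto

lemma place_cong:
  assumes "\<And>k. k \<le> v \<Longrightarrow> v < k + N \<Longrightarrow> k \<in> P \<longleftrightarrow> k \<in> Q"
  shows "place a N x P v = place a N x Q v"
proof -
  have "(\<lambda>k. k \<in> P \<and> k \<le> v \<and> v < k + N) = (\<lambda>k. k \<in> Q \<and> k \<le> v \<and> v < k + N)"
    using assms by blast
  from arg_cong[OF this, of Ex] arg_cong[OF this, of Eps] show ?thesis
    unfolding place_def by (simp only:)
qed

text \<open>At the least element of the symmetric difference, one side shows \<open>x 0\<close>,
  which is not \<open>a\<close>. The other side must cover this position by a copy that starts
  further left; its start lies in both sets, too close to that element.\<close>

lemma place_inject:
  assumes "finite P" "finite Q" "separated N P" "separated N Q" "0 < N" "x 0 \<noteq> a"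
    and eq: "place a N x P = place a N x Q"
  shows "P = Q"
proof (rule ccontr)
  assume "P \<noteq> Q"
  define D where "D = (P - Q) \<union> (Q - P)"
  have D: "finite D" "D \<noteq> {}" using assms(1,2) \<open>P \<noteq> Q\<close> by (auto simp: D_def)
  have *: False if PQ: "separated N P'" "separated N Q'" "place a N x P' = place a N x Q'"
      "D = (P' - Q') \<union> (Q' - P')" "Min D \<in> P'" "Min D \<notin> Q'" for P' Q'
  proof -
    have "place a N x P' (Min D) = x 0"
      using place_in[OF PQ(1) PQ(5)] assms(5) by simp
    then have "place a N x Q' (Min D) \<noteq> a" using PQ(3) assms(6) by simp
    then obtain l where l: "l \<in> Q'" "l \<le> Min D" "Min D < l + N"
      using place_out by metis
    have "l \<notin> D" using l(1,2) PQ(6) Min_le[OF D(1), of l] by (cases "l = Min D") auto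
    then have "l \<in> P'" using l(1) PQ(4) by blast
    moreover have "l \<noteq> Min D" using l(1) PQ(6) by blast
    ultimately have "N \<le> \<bar>Min D - l\<bar>" using PQ(1,5) by (simp add: separated_def)
    then show False using l(2,3) by linarith
  qed
  have "Min D \<in> D" using D by simp
  then show False
    using *[of P Q] *[of Q P] assms(3,4) eq unfolding D_def by (metis DiffE UnE sup_commute)
qed

text \<open>Membership in an SFT is local: every window of \<open>y\<close> of radius
  \<open>W\<close> only has to occur in \<open>x\<close>, possibly at a different translate for each
  window.\<close>

lemma avoiding_if_locally:
  assumes x: "x \<in> avoiding A F" and W: "\<And>p v. p \<in> F \<Longrightarrow> v \<in> dom p \<Longrightarrow> \<bar>v\<bar> \<le> W" and "0 \<le> W"
    and window: "\<And>u. \<exists>k. \<forall>v. \<bar>v - u\<bar> \<le> W \<longrightarrow> y v = x (v - k)"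
  shows "y \<in> avoiding A F"
proof -
  have "range y \<subseteq> A"
  proof
    fix b assume "b \<in> range y"
    then obtain v where "b = y v" by blast
    moreover obtain k where "y v = x (v - k)"
      using window[of v] \<open>0 \<le> W\<close> by force
    ultimately show "b \<in> A" using x by (auto simp: avoiding_def)
  qed
  moreover have "\<not> appears p y" if "p \<in> F" for p
  proof
    assume "appears p y"
    then obtain u where u: "\<And>v b. p v = Some b \<Longrightarrow> y (v + u) = b"
      unfolding appears_iff by blast
    obtain k where k: "\<And>v. \<bar>v - u\<bar> \<le> W \<Longrightarrow> y v = x (v - k)"
      using window[of u] by blast
    have "x (v + (u - k)) = b" if "p v = Some b" for v b
    proof -
      have "\<bar>v + u - u\<bar> \<le> W" using W[OF \<open>p \<in> F\<close>, of v] that by auto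
      from k[OF this] u[OF that] show ?thesis by (simp add: algebra_simps)
    qed
    then have "appears p x" unfolding appears_iff by blast
    then show False using x \<open>p \<in> F\<close> by (auto simp: avoiding_def)
  qed
  ultimately show ?thesis by (simp add: avoiding_def)
qed

text \<open>The gaps are so large that a window of radius \<open>W\<close> meets at most one copy,
  hence looks like a part of \<open>x\<close>.\<close>

lemma place_in_avoiding:
  assumes x: "x \<in> avoiding A F"
    and out: "\<And>v. v < 0 \<or> N \<le> v \<Longrightarrow> x v = a" and N: "0 < N"
    and W: "\<And>p v. p \<in> F \<Longrightarrow> v \<in> dom p \<Longrightarrow> \<bar>v\<bar> \<le> W"
    and P: "separated (N + 2 * W + 1) P" and "0 \<le> W"
  shows "place a N x P \<in> avoiding A F"
proof -
  have sep: "separated N P" using P \<open>0 \<le> W\<close> unfolding separated_def by force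
  show ?thesis
  proof (rule avoiding_if_locally[OF x W \<open>0 \<le> W\<close>])
    fix u
    show "\<exists>k. \<forall>v. \<bar>v - u\<bar> \<le> W \<longrightarrow> place a N x P v = x (v - k)"
    proof (cases "\<exists>k\<in>P. \<exists>v. \<bar>v - u\<bar> \<le> W \<and> k \<le> v \<and> v < k + N")
      case True
      then obtain k w where k: "k \<in> P" "\<bar>w - u\<bar> \<le> W" "k \<le> w" "w < k + N" by blast
      have "place a N x P v = x (v - k)" if v: "\<bar>v - u\<bar> \<le> W" for v
      proof (cases "k \<le> v \<and> v < k + N")
        case True
        then show ?thesis using place_in[OF sep k(1)] by blast
      next
        case False
        have "place a N x P v = a"
        proof (rule place_out)
          fix l assume l: "l \<in> P" "l \<le> v" "v < l + N"
          then have "l \<noteq> k" using False by blast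
          then have "N + 2 * W + 1 \<le> \<bar>k - l\<bar>" using P k(1) l(1) by (simp add: separated_def)
          then show False using l k v by linarith
        qed
        moreover have "x (v - k) = a" using False by (intro out) auto
        ultimately show ?thesis by simp
      qed
      then show ?thesis by blast
    next
      case False
      \<comment> \<open>A window that meets no copy is constant. This translation carries it to the
        positions from \<open>- 2 * W - 1\<close> to \<open>- 1\<close>, where \<open>x\<close> is
        \<open>a\<close> as well.\<close>
      have "place a N x P v = x (v - (u + W + 1))" if v: "\<bar>v - u\<bar> \<le> W" for v
      proof -
        have "place a N x P v = a" using False v by (intro place_out) blast
        moreover have "x (v - (u + W + 1)) = a" using v by (intro out) linarith
        ultimately show ?thesis by simp
      qed
      then show ?thesis by blast
    qed
  qed
qed

text \<open>
  Two ones at a small distance \<open>n\<close> are moved apart. As \<open>n\<close> is odd, the even distances are free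
  to be used for this.
\<close>

definition marks :: "int \<Rightarrow> config \<Rightarrow> int set" where
  "marks M y = {k. y k = 1 \<and> (\<forall>n. 0 < n \<and> n < M \<longrightarrow> y (k - n) \<noteq> 1)
     \<or> (\<exists>n. 0 < n \<and> n < M \<and> y (k - 2 * (M + n)) = 1 \<and> y (k - 2 * (M + n) + n) = 1)}"

lemma marks_shift: "marks M (shift u y) = {k. k + u \<in> marks M y}"
  by (simp add: marks_def shift_def algebra_simps)

lemma marks_empty: "marks M (ones {}) = {}"
  by (simp add: marks_def ones_def)

lemma marks_single: "marks M (ones {i}) = {i}"
  by (auto simp: marks_def)

definition spread :: "int \<Rightarrow> int \<Rightarrow> int" where
  "spread M n = (if n < M then 2 * (M + n) else n)"

text \<open>The left one is always kept. The right one is kept if \<open>n\<close> is at least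
  \<open>M\<close>; otherwise the second clause of \<open>marks\<close> replaces it by a mark at
  distance \<open>2 * (M + n)\<close> from the left one.\<close>

lemma marks_pair:
  assumes "0 < n"
  shows "marks M (ones {i, i + n}) = {i, i + spread M n}"
  using assms unfolding marks_def spread_def ones_eq_1
  by (auto; smt (verit))

text \<open>Distances that are changed become even, those that are kept are odd, so the two cases
  never collide.\<close>

lemma spread_inject:
  assumes "odd m" "odd n" "spread M m = spread M n"
  shows "m = n"
  using assms unfolding spread_def by (auto split: if_splits)

lemma spread_ge: "0 < n \<Longrightarrow> 0 \<le> M \<Longrightarrow> M \<le> spread M n" "0 < n \<Longrightarrow> 0 \<le> M \<Longrightarrow> 0 < spread M n"
  by (auto simp: spread_def)

lemma marks_finite_separated:
  assumes "y \<in> halting_subshift" and "0 \<le> M"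
  shows "finite (marks M y)" "separated M (marks M y)"
  using assms(1)
  by (cases rule: halting_subshift_cases;
      use spread_ge assms(2) in \<open>force simp: marks_empty marks_single marks_pair separated_def\<close>)+

text \<open>The number of marks tells the three kinds of points apart, the left mark gives the
  position, and \<open>spread_inject\<close> recovers the distance.\<close>

lemma inj_on_marks:
  assumes "0 \<le> M"
  shows "inj_on (marks M) halting_subshift"
proof (rule inj_onI)
  fix y z assume y: "y \<in> halting_subshift" and z: "z \<in> halting_subshift"
    and eq: "marks M y = marks M z"
  have pairs: "{i, i + s} = {j, j + t} \<longleftrightarrow> i = j \<and> s = t" if "0 < s" "0 < t" for i j s t :: int
    using that by (auto simp: doubleton_eq_iff)
  have single: "{i, i + s} \<noteq> {j}" "{j} \<noteq> {i, i + s}" if "0 < s" for i j s :: int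
    using that by auto
  have spread: "spread M m = spread M n \<longleftrightarrow> m = n" if "odd m" "odd n" for m n
    using spread_inject that by blast
  have pos: "0 < spread M n" "spread M n \<noteq> 0" if "0 < n" for n
    using spread_ge(2)[OF that assms] by simp_all
  show "y = z"
    using y z eq
    by (elim halting_subshift_cases)
      (simp_all add: marks_empty marks_single marks_pair pairs single spread pos)
qed

section \<open>The embedding built from a homoclinic point\<close>

lemma embeds_if_homoclinic:
  assumes sft: "(A, F) \<in> sft_inputs" and "x \<in> avoiding A F" "homoclinic x"
  shows "halting_subshift \<hookrightarrow> avoiding A F"
proof -
  obtain a where fin: "finite {v. x v \<noteq> a}" and ex: "{v. x v \<noteq> a} \<noteq> {}"
    using assms(3) unfolding homoclinic_def by blast
  define m where "m = Min {v. x v \<noteq> a}"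
  define N where "N = Max {v. x v \<noteq> a} - m + 1"
  \<comment> \<open>The leftmost exceptional position moves to 0, so that
    \<open>z 0 \<noteq> a\<close>, as \<open>place_inject\<close> requires.\<close>
  define z where "z = shift m x"
  have m: "m \<in> {v. x v \<noteq> a}" unfolding m_def by (rule Min_in[OF fin ex])
  have bounds: "m \<le> v" "v < m + N" if "x v \<noteq> a" for v
    using that Min_le[OF fin, of v] Max_ge[OF fin, of v] by (auto simp: m_def N_def)
  have z: "z \<in> avoiding A F" unfolding z_def by (rule shift_in_avoiding[OF assms(2)])
  have z0: "z 0 \<noteq> a" using m by (simp add: z_def shift_def)
  have out: "z v = a" if "v < 0 \<or> N \<le> v" for v
    using bounds[of "v + m"] that by (force simp: z_def shift_def)
  have N: "0 < N" using bounds[of m] m by force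
  have "finite (\<Union>p\<in>F. dom p)" using sft by (auto simp: sft_inputs_def patterns_def)
  then obtain W where W: "0 \<le> W" "\<And>p v. p \<in> F \<Longrightarrow> v \<in> dom p \<Longrightarrow> \<bar>v\<bar> \<le> W"
  proof -
    let ?V = "insert 0 (abs ` (\<Union>p\<in>F. dom p))"
    have V: "finite ?V" using \<open>finite (\<Union>p\<in>F. dom p)\<close> by simp
    have "0 \<le> Max ?V" "\<And>p v. p \<in> F \<Longrightarrow> v \<in> dom p \<Longrightarrow> \<bar>v\<bar> \<le> Max ?V"
      using V by (intro Max_ge; blast)+
    then show thesis using that by blast
  qed
  define M where "M = N + 2 * W + 1"
  have M: "0 \<le> M" "N \<le> M" using N W(1) by (simp_all add: M_def)
  define \<phi> where "\<phi> y = place a N z (marks M y)" for y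
  have sep: "separated N (marks M y)" if "y \<in> halting_subshift" for y
    using marks_finite_separated(2)[OF that M(1)] M(2) unfolding separated_def by force
  show ?thesis
    unfolding embeds_def
  proof (intro exI[of _ \<phi>] conjI allI ballI)
    show "\<phi> ` halting_subshift \<subseteq> avoiding A F"
    proof (rule image_subsetI)
      fix y assume "y \<in> halting_subshift"
      then have "separated (N + 2 * W + 1) (marks M y)"
        using marks_finite_separated(2) M(1) unfolding M_def by blast
      with z out N W(2) show "\<phi> y \<in> avoiding A F"
        unfolding \<phi>_def using W(1) by (rule place_in_avoiding)
    qed
    show "inj_on \<phi> halting_subshift"
    proof (rule inj_onI)
      fix y y' assume y: "y \<in> halting_subshift" "y' \<in> halting_subshift" "\<phi> y = \<phi> y'"
      have "marks M y = marks M y'"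
        using marks_finite_separated(1)[OF y(1) M(1)] marks_finite_separated(1)[OF y(2) M(1)]
          sep[OF y(1)] sep[OF y(2)] N z0 y(3)
        unfolding \<phi>_def by (rule place_inject)
      then show "y = y'" using inj_onD[OF inj_on_marks[OF M(1)]] y by blast
    qed
    show "\<phi> (shift u y) = shift u (\<phi> y)" if y: "y \<in> halting_subshift" for u y
    proof
      fix v
      have sep': "separated N {k. k + u \<in> marks M y}"
        using sep[OF y] unfolding separated_def by force
      show "\<phi> (shift u y) v = shift u (\<phi> y) v"
      proof (cases "\<exists>k. k \<in> marks M y \<and> k \<le> v + u \<and> v + u < k + N")
        case True
        then obtain k where k: "k \<in> marks M y" "k \<le> v + u" "v + u < k + N" by blast
        have "\<phi> (shift u y) v = z (v - (k - u))"
          unfolding \<phi>_def marks_shift by (rule place_in[OF sep']) (use k in auto)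
        moreover have "\<phi> y (v + u) = z (v + u - k)"
          unfolding \<phi>_def by (rule place_in[OF sep[OF y] k])
        ultimately show ?thesis by (simp add: shift_def algebra_simps)
      next
        case False
        have "\<phi> (shift u y) v = a"
          unfolding \<phi>_def marks_shift
        proof (rule place_out)
          fix k assume "k \<in> {k. k + u \<in> marks M y}" "k \<le> v" "v < k + N"
          then show False using False by (auto dest!: spec[of _ "k + u"])
        qed
        moreover have "\<phi> y (v + u) = a"
          unfolding \<phi>_def using False by (intro place_out) blast
        ultimately show ?thesis by (simp add: shift_def)
      qed
    qed
    show "continuous_on halting_subshift \<phi>"
    proof (intro continuous_on_coordinatewise_then_product continuous_on_local)
      fix v
      \<comment> \<open>A copy that covers \<open>v\<close> starts less than
        \<open>N \<le> M\<close> to its left, and \<open>marks\<close> reads less than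
        \<open>4 * M\<close> further left.\<close>
      show "finite {v - 5 * M..v + 5 * M}" by simp
      fix y y' :: config
      assume eq: "\<And>w. w \<in> {v - 5 * M..v + 5 * M} \<Longrightarrow> y w = y' w"
      have "k \<in> marks M y \<longleftrightarrow> k \<in> marks M y'" if "k \<le> v" "v < k + N" for k
      proof -
        have "y (k - n) = y' (k - n)" "y (k - 2 * (M + n)) = y' (k - 2 * (M + n))"
            "y (k - 2 * (M + n) + n) = y' (k - 2 * (M + n) + n)" if "0 \<le> n" "n < M" for n
          using \<open>k \<le> v\<close> \<open>v < k + N\<close> that M by (auto intro!: eq)
        moreover from this(1)[of 0] have "y k = y' k" using M(2) N by simp
        ultimately show ?thesis by (auto simp: marks_def)
      qed
      then show "\<phi> y v = \<phi> y' v" unfolding \<phi>_def by (rule place_cong)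
    qed
  qed
qed

lemma embeds_iff_homoclinic:
  assumes "(A, F) \<in> sft_inputs"
  shows "halting_subshift \<hookrightarrow> avoiding A F \<longleftrightarrow> (\<exists>x\<in>avoiding A F. homoclinic x)"
  using homoclinic_if_embeds embeds_if_homoclinic[OF assms] by blast

section \<open>Deciding the existence of homoclinic points\<close>

text \<open>The segment from \<open>i\<close> up to \<open>k\<close> is removed. A window of radius
  \<open>w\<close> either starts at or after \<open>i\<close> and sees a translate of
  \<open>x\<close>, or ends before \<open>i + 2 * w\<close>, where the agreement of the two words
  makes the cut invisible.\<close>

lemma avoiding_cut:
  assumes x: "x \<in> avoiding A F" and W: "\<And>p v. p \<in> F \<Longrightarrow> v \<in> dom p \<Longrightarrow> \<bar>v\<bar> \<le> int w"
    and eq: "\<And>d. d \<in> {0..<2 * w + 1} \<Longrightarrow> x (i + int d) = x (k + int d)"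
  shows "(\<lambda>v. if v < i then x v else x (v + (k - i))) \<in> avoiding A F" (is "?y \<in> _")
proof (rule avoiding_if_locally[OF x W])
  fix u
  show "\<exists>l. \<forall>v. \<bar>v - u\<bar> \<le> int w \<longrightarrow> ?y v = x (v - l)"
  proof (cases "i \<le> u - int w")
    case True
    then show ?thesis by (intro exI[of _ "i - k"]) (auto simp: algebra_simps)
  next
    case False
    have "?y v = x (v - 0)" if "\<bar>v - u\<bar> \<le> int w" for v
    proof (cases "v < i")
      case ge: False
      have "x (i + int (nat (v - i))) = x (k + int (nat (v - i)))"
        by (rule eq) (use False ge that in auto)
      then show ?thesis using ge by (simp add: algebra_simps)
    qed simp
    then show ?thesis by blast
  qed
qed simp_all

text \<open>Take the least possible length \<open>n\<close>. If it exceeds the number of words of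
  length \<open>2 * w + 1\<close>, the pigeonhole principle gives two equal words, and cutting
  between them gives a shorter point.\<close>

lemma short_homoclinic:
  assumes x: "x \<in> avoiding A F" and "homoclinic x" and A: "finite A"
    and W: "\<And>p v. p \<in> F \<Longrightarrow> v \<in> dom p \<Longrightarrow> \<bar>v\<bar> \<le> int w"
  obtains y a where "y \<in> avoiding A F" "a \<in> A" "y 0 \<noteq> a"
    "\<And>v. y v \<noteq> a \<Longrightarrow> 0 \<le> v \<and> v < int (card A ^ (2 * w + 1))"
proof -
  obtain a where fin: "finite {v. x v \<noteq> a}" and ex: "{v. x v \<noteq> a} \<noteq> {}"
    using assms(2) unfolding homoclinic_def by blast
  obtain v where "v \<notin> {v. x v \<noteq> a}"
    using fin infinite_UNIV_int by (metis ex_new_if_finite)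
  then have "a \<in> A" using x by (auto simp: avoiding_def)
  define short where "short n y \<longleftrightarrow> y \<in> avoiding A F \<and> y 0 \<noteq> a
    \<and> (\<forall>v. y v \<noteq> a \<longrightarrow> 0 \<le> v \<and> v < int n)" for n y
  define m where "m = Min {v. x v \<noteq> a}"
  have m: "x m \<noteq> a" using Min_in[OF fin ex] unfolding m_def by blast
  have "short (nat (Max {v. x v \<noteq> a} - m + 1)) (shift m x)"
    unfolding short_def
  proof (intro conjI allI impI)
    fix v assume "shift m x v \<noteq> a"
    then have v: "v + m \<in> {v. x v \<noteq> a}" by (simp add: shift_def)
    show "0 \<le> v" "v < int (nat (Max {v. x v \<noteq> a} - m + 1))"
      using Min_le[OF fin v] Max_ge[OF fin v] unfolding m_def by linarith+
  qed (use shift_in_avoiding[OF x] m in \<open>auto simp: shift_def\<close>)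
  then have ex: "\<exists>n. \<exists>y. short n y" by blast
  define n where "n = (LEAST n. \<exists>y. short n y)"
  obtain y where y: "short n y" using LeastI_ex[OF ex] unfolding n_def by blast
  have "n \<le> card A ^ (2 * w + 1)"
  proof (rule ccontr)
    assume n: "\<not> n \<le> card A ^ (2 * w + 1)"
    let ?L = "{xs. set xs \<subseteq> A \<and> length xs = 2 * w + 1}"
    let ?win = "\<lambda>i. map (\<lambda>d. y (int i + int d)) [0..<2 * w + 1]"
    have "y v \<in> A" for v using y by (auto simp: short_def avoiding_def)
    \<comment> \<open>Starting at 1 rather than 0 keeps position 0, whose letter differs from
      \<open>a\<close>, out of the cut; the result stays nonconstant.\<close>
    then have "?win ` {1..n} \<subseteq> ?L" by (auto simp del: upt_Suc)
    moreover have "card ?L < card {1..n}"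
      using n card_lists_length_eq[OF A, of "2 * w + 1"] by simp
    ultimately have "\<not> inj_on ?win {1..n}"
      using card_inj_on_le[OF _ _ finite_lists_length_eq[OF A], of ?win "{1..n}" "2 * w + 1"] by linarith
    then obtain i k where ik: "?win i = ?win k" "i \<in> {1..n}" "k \<in> {1..n}" "i < k"
      unfolding inj_on_def by (metis linorder_neqE_nat)
    let ?y = "\<lambda>v. if v < int i then y v else y (v + (int k - int i))"
    have "?y \<in> avoiding A F"
    proof (rule avoiding_cut[OF _ W])
      show "y \<in> avoiding A F" using y by (simp add: short_def)
      fix d assume d: "d \<in> {0..<2 * w + 1}"
      have "?win i ! d = ?win k ! d" by (simp only: ik(1))
      then show "y (int i + int d) = y (int k + int d)" using d by (simp del: upt_Suc)
    qed
    moreover have "0 \<le> v \<and> v < int (n - (k - i))" if "?y v \<noteq> a" for v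
    proof (cases "v < int i")
      case True
      then have "y v \<noteq> a" using that by simp
      then show ?thesis using y True ik(2-4) by (auto simp: short_def)
    next
      case False
      then have "y (v + (int k - int i)) \<noteq> a" using that by simp
      then show ?thesis using y False ik(2-4) by (force simp: short_def)
    qed
    ultimately have "short (n - (k - i)) ?y"
      using y ik(2) by (simp add: short_def)
    moreover have "n - (k - i) < n" using ik by auto
    ultimately show False unfolding n_def using not_less_Least by blast
  qed
  then have le: "int n \<le> int (card A ^ (2 * w + 1))" by (rule of_nat_mono)
  show thesis
  proof (rule that)
    show "y \<in> avoiding A F" "a \<in> A" "y 0 \<noteq> a" using y \<open>a \<in> A\<close> by (simp_all add: short_def)
    show "0 \<le> v \<and> v < int (card A ^ (2 * w + 1))" if "y v \<noteq> a" for v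
    proof -
      have "0 \<le> v \<and> v < int n" using y that unfolding short_def by blast
      then show ?thesis using le by linarith
    qed
  qed
qed

section \<open>Recognising codes of patterns\<close>

definition pattern_ok :: "nat \<Rightarrow> nat \<Rightarrow> bool" where
  "pattern_ok al c \<longleftrightarrow> (\<forall>k<c. \<forall>b<c. prod_encode (k, b) \<in> set_decode c \<longrightarrow> b \<in> set_decode al
     \<and> (\<forall>b'<c. prod_encode (k, b') \<in> set_decode c \<longrightarrow> b = b'))"

lemma set_decode_prod_less:
  assumes "prod_encode (k, b) \<in> set_decode c"
  shows "k < c" "b < c"
  using set_decode_less[OF assms] le_prod_encode_1[of k b] le_prod_encode_2[of b k] by linarith+

lemma mem_pattern_code:
  assumes "finite (dom p)"
  shows "prod_encode (k, b) \<in> set_decode (pattern_code p) \<longleftrightarrow> p (int_decode k) = Some b"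
proof -
  have "finite (Map.graph p)" using assms by (simp add: finite_graph_iff_finite_dom)
  then have "set_decode (pattern_code p) = (\<lambda>(v, a). prod_encode (int_encode v, a)) ` Map.graph p"
    by (simp add: pattern_code_def)
  then show ?thesis
    by (auto simp: Map.graph_def image_iff)
qed

text \<open>Every number codes a finite set of pairs. It codes a pattern precisely when this
  relation is single-valued and its letters belong to the alphabet.\<close>

lemma pattern_code_image: "pattern_code ` patterns (set_decode al) = {c. pattern_ok al c}"
proof (intro equalityI subsetI)
  fix c assume "c \<in> pattern_code ` patterns (set_decode al)"
  then obtain p where "finite (dom p)" "ran p \<subseteq> set_decode al" "c = pattern_code p"
    by (auto simp: patterns_def)
  then show "c \<in> {c. pattern_ok al c}"
    by (auto simp: pattern_ok_def mem_pattern_code ran_def)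
next
  fix c assume "c \<in> {c. pattern_ok al c}"
  then have ok: "b \<in> set_decode al" "\<And>b'. prod_encode (k, b') \<in> set_decode c \<Longrightarrow> b' = b"
    if "prod_encode (k, b) \<in> set_decode c" for k b
    using that set_decode_prod_less[of _ _ c] unfolding pattern_ok_def by blast+
  define p :: pattern where "p v = (if \<exists>b. prod_encode (int_encode v, b) \<in> set_decode c
    then Some (THE b. prod_encode (int_encode v, b) \<in> set_decode c) else None)" for v
  have p_if: "p v = Some b" if "prod_encode (int_encode v, b) \<in> set_decode c" for v b
  proof -
    have "(THE b. prod_encode (int_encode v, b) \<in> set_decode c) = b"
      using that ok(2) by (intro the_equality) blast+
    then show ?thesis using that unfolding p_def by auto
  qed
  have p: "p v = Some b \<longleftrightarrow> prod_encode (int_encode v, b) \<in> set_decode c" for v b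
  proof
    assume "p v = Some b"
    moreover from this obtain b' where "prod_encode (int_encode v, b') \<in> set_decode c"
      unfolding p_def by (auto split: if_splits)
    ultimately show "prod_encode (int_encode v, b) \<in> set_decode c" using p_if[of v b'] by simp
  qed (rule p_if)
  have graph: "(\<lambda>(v, a). prod_encode (int_encode v, a)) ` Map.graph p = set_decode c"
  proof (intro equalityI subsetI)
    fix e assume e: "e \<in> set_decode c"
    obtain k b where kb: "e = prod_encode (k, b)"
      by (metis prod_decode_inverse surj_pair)
    then have "p (int_decode k) = Some b" using e by (simp add: p)
    then show "e \<in> (\<lambda>(v, a). prod_encode (int_encode v, a)) ` Map.graph p"
      unfolding kb by (intro image_eqI[of _ _ "(int_decode k, b)"]) (auto simp: Map.graph_def)
  qed (auto simp: Map.graph_def p)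
  have "finite (Map.graph p)"
    by (rule finite_imageD[of "\<lambda>(v, a). prod_encode (int_encode v, a)"])
      (auto simp: graph inj_on_def int_encode_eq)
  then have "finite (dom p)" by (simp add: finite_graph_iff_finite_dom)
  moreover have "ran p \<subseteq> set_decode al" using ok(1) by (auto simp: ran_def p)
  moreover have "pattern_code p = c" by (simp add: pattern_code_def graph)
  ultimately show "c \<in> pattern_code ` patterns (set_decode al)"
    by (auto simp: patterns_def)
qed

text \<open>
  The number \<open>X\<close> codes the finite set of pairs \<open>(j, b)\<close> with \<open>x j = b \<noteq> a\<close>. As codes of patterns
  of the input are less than \<open>s\<close>, so are their positions in absolute value; the exceptional
  positions are put at \<open>2 * s\<close> and above in order to stay in the natural numbers.
\<close>

definition letter_at :: "nat \<Rightarrow> nat \<Rightarrow> nat \<Rightarrow> nat \<Rightarrow> bool" where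
  "letter_at a X j b \<longleftrightarrow> prod_encode (j, b) \<in> set_decode X
     \<or> b = a \<and> (\<forall>b'<X. prod_encode (j, b') \<notin> set_decode X)"

text \<open>The integer equation of \<open>position_iff\<close> in natural numbers:
  \<open>int_decode\<close> sends \<open>2 * h\<close> to \<open>h\<close> and
  \<open>Suc (2 * h)\<close> to \<open>- (h + 1)\<close>.\<close>

definition position :: "nat \<Rightarrow> nat \<Rightarrow> nat \<Rightarrow> bool" where
  "position u k j \<longleftrightarrow> (\<exists>h<Suc k. k = 2 * h \<and> j = u + h \<or> k = Suc (2 * h) \<and> j + Suc h = u)"

definition occurs :: "nat \<Rightarrow> nat \<Rightarrow> nat \<Rightarrow> nat \<Rightarrow> bool" where
  "occurs a X c u \<longleftrightarrow> (\<forall>k<c. \<forall>b<c. prod_encode (k, b) \<in> set_decode c \<longrightarrow>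
     (\<exists>j<Suc (u + k). position u k j \<and> letter_at a X j b))"

definition exceptions :: "nat \<Rightarrow> nat \<Rightarrow> nat \<Rightarrow> nat \<Rightarrow> bool" where
  "exceptions al s a X \<longleftrightarrow> 0 < X \<and> (\<forall>j<X. \<forall>b<X. prod_encode (j, b) \<in> set_decode X \<longrightarrow>
     b \<in> set_decode al \<and> \<not> b = a \<and> 2 * s \<le> j
     \<and> (\<forall>b'<X. prod_encode (j, b') \<in> set_decode X \<longrightarrow> b' = b))"

text \<open>The bound on \<open>X\<close> comes from \<open>short_homoclinic\<close> with radius
  \<open>s\<close>: there are at most \<open>al\<close> letters, all below \<open>al\<close>, and
  positions are translated by \<open>2 * s\<close>. An offset \<open>u\<close> outside
  \<open>s..<X + s\<close> shows a pattern only the letter \<open>a\<close>, and so does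
  \<open>u = s\<close>.\<close>

definition homoclinic_code :: "nat \<Rightarrow> nat \<Rightarrow> bool" where
  "homoclinic_code al s \<longleftrightarrow> (\<exists>a<al. a \<in> set_decode al
     \<and> (\<exists>X<2 ^ prod_encode (2 * s + al ^ (2 * s + 1), al). exceptions al s a X
       \<and> (\<forall>c<s. c \<in> set_decode s \<longrightarrow> (\<forall>u<X + s. s \<le> u \<longrightarrow> \<not> occurs a X c u))))"

section \<open>Correctness of the bounded search\<close>

lemma position_iff: "position u k j \<longleftrightarrow> int j = int u + int_decode k"
proof (cases "even k")
  case True
  then obtain h where k: "k = 2 * h" by (elim evenE)
  have "position u k j \<longleftrightarrow> j = u + h"
    unfolding position_def k by (auto; presburger)
  then show ?thesis by (auto simp: k int_decode_def sum_decode_def)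
next
  case False
  then obtain h where k: "k = Suc (2 * h)" by (metis oddE Suc_eq_plus1)
  have "position u k j \<longleftrightarrow> j + Suc h = u"
    unfolding position_def k by (auto; presburger)
  then show ?thesis by (auto simp: k int_decode_def sum_decode_def)
qed

lemma abs_int_decode_le: "\<bar>int_decode k\<bar> \<le> int k"
proof (cases "even k")
  case True
  then show ?thesis by (auto simp: int_decode_def sum_decode_def elim: evenE)
next
  case False
  then show ?thesis by (auto simp: int_decode_def sum_decode_def elim: oddE)
qed

lemma prod_encode_strict_mono:
  assumes "j < j'" "b < b'"
  shows "prod_encode (j, b) < prod_encode (j', b')"
proof -
  have "mono triangle" by (simp add: mono_iff_le_Suc)
  then have "triangle (j + b) \<le> triangle (j' + b')" by (rule monoD) (use assms in simp)
  then show ?thesis using assms by (simp add: prod_encode_def)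
qed

lemma set_encode_less:
  assumes "S \<subseteq> {..<m}"
  shows "set_encode S < 2 ^ m"
proof -
  have "set_encode S \<le> set_encode {..<m}"
    unfolding set_encode_def using assms finite_subset[OF assms] by (auto intro: sum_mono2)
  also have "\<dots> < 2 ^ m"
    by (simp add: set_encode_def lessThan_atLeast0 sum_power2)
  finally show ?thesis .
qed

lemma homoclinic_code_iff:
  assumes sft: "(A, F) \<in> sft_inputs" and al: "al = set_encode A" and s: "s = set_encode (pattern_code ` F)"
  shows "homoclinic_code al s \<longleftrightarrow> (\<exists>x\<in>avoiding A F. homoclinic x)"
proof -
  have fin: "finite A" "finite F" and dom: "\<And>p. p \<in> F \<Longrightarrow> finite (dom p)"
    using sft by (auto simp: sft_inputs_def patterns_def)
  have decode: "set_decode al = A" "set_decode s = pattern_code ` F"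
    using fin by (simp_all add: al s)
  have code_less: "pattern_code p < s" if "p \<in> F" for p
    by (rule set_decode_less) (use that decode in auto)
  have bound: "\<bar>v\<bar> < int s" if "p \<in> F" "p v = Some b" for p v b
  proof -
    have "prod_encode (int_encode v, b) \<in> set_decode (pattern_code p)"
      using that dom by (simp add: mem_pattern_code)
    then have "int_encode v < s"
      using set_decode_prod_less(1) code_less[OF that(1)] by (meson less_trans)
    then show ?thesis using abs_int_decode_le[of "int_encode v"] by simp
  qed
  show ?thesis
  proof
    assume "homoclinic_code al s"
    then obtain a X where a: "a \<in> A" and exc: "exceptions al s a X"
      and no_occ: "\<And>p u. p \<in> F \<Longrightarrow> s \<le> u \<Longrightarrow> u < X + s \<Longrightarrow> \<not> occurs a X (pattern_code p) u"
      unfolding homoclinic_code_def decode using code_less by blast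
    have X: "b \<in> A" "b \<noteq> a" "2 * s \<le> j" "\<And>b'. prod_encode (j, b') \<in> set_decode X \<Longrightarrow> b' = b"
      if "prod_encode (j, b) \<in> set_decode X" for j b
      using exc that set_decode_prod_less[of _ _ X] unfolding exceptions_def decode by blast+
    define x where "x v = (if 0 \<le> v \<and> (\<exists>b. prod_encode (nat v, b) \<in> set_decode X)
      then (THE b. prod_encode (nat v, b) \<in> set_decode X) else a)" for v :: int
    have x_exc: "x (int j) = b" if "prod_encode (j, b) \<in> set_decode X" for j b
    proof -
      have "(THE b. prod_encode (j, b) \<in> set_decode X) = b"
        using that X(4) by (intro the_equality) blast+
      then show ?thesis using that unfolding x_def by auto
    qed
    have x_a: "x v = a" if "\<And>j b. v = int j \<Longrightarrow> prod_encode (j, b) \<notin> set_decode X" for v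
      using that[of "nat v"] by (auto simp: x_def)
    have letter: "letter_at a X j (x (int j))" for j
      using x_exc[of j] x_a[of "int j"] unfolding letter_at_def by (metis of_nat_eq_iff)
    have out: "x v = a" if "v < 2 * int s \<or> int X \<le> v" for v
      using that X(3) set_decode_prod_less(1)[of _ _ X] by (intro x_a) fastforce
    have "0 < X" using exc by (simp add: exceptions_def)
    have "x v \<in> A" for v
    proof (cases "\<exists>j b. v = int j \<and> prod_encode (j, b) \<in> set_decode X")
      case True
      then show ?thesis using x_exc X(1) by blast
    next
      case False
      then show ?thesis using x_a a by metis
    qed
    moreover have "\<not> appears p x" if p: "p \<in> F" for p
    proof
      assume "appears p x"
      then obtain U where U: "\<And>v b. p v = Some b \<Longrightarrow> x (v + U) = b"
        unfolding appears_iff by blast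
      have "\<exists>u. s \<le> u \<and> u < X + s \<and> (\<forall>v b. p v = Some b \<longrightarrow> x (v + int u) = b)"
      proof (cases "int s \<le> U \<and> U < int (X + s)")
        case True
        then show ?thesis using U by (intro exI[of _ "nat U"]) auto
      next
        case False
        \<comment> \<open>An occurrence outside the tested range sees only \<open>a\<close>. Around
          \<open>s\<close> everything is \<open>a\<close> too, since exceptional positions begin at
          \<open>2 * s\<close>.\<close>
        have "x (v + int s) = b" if v: "p v = Some b" for v b
        proof -
          have "x (v + U) = a" using False bound[OF p v] by (intro out) auto
          moreover have "x (v + int s) = a" using bound[OF p v] by (intro out) auto
          ultimately show ?thesis using U[OF v] by simp
        qed
        then show ?thesis using \<open>0 < X\<close> by (intro exI[of _ s]) auto
      qed
      then obtain u where u: "s \<le> u" "u < X + s" "\<And>v b. p v = Some b \<Longrightarrow> x (v + int u) = b"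
        by blast
      have "occurs a X (pattern_code p) u"
        unfolding occurs_def
      proof (intro allI impI)
        fix k b assume "prod_encode (k, b) \<in> set_decode (pattern_code p)"
        then have v: "p (int_decode k) = Some b" by (simp add: mem_pattern_code dom[OF p])
        define j where "j = nat (int u + int_decode k)"
        have j: "int j = int u + int_decode k"
          using bound[OF p v] u(1) by (simp add: j_def)
        have "letter_at a X j b"
          using letter[of j] u(3)[OF v] by (simp add: j add.commute)
        moreover have "j < Suc (u + k)" using j abs_int_decode_le[of k] by linarith
        ultimately show "\<exists>j<Suc (u + k). position u k j \<and> letter_at a X j b"
          using j by (auto simp: position_iff)
      qed
      then show False using no_occ[OF p u(1,2)] by blast
    qed
    ultimately have "x \<in> avoiding A F" by (auto simp: avoiding_def)
    moreover have "homoclinic x"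
    proof -
      have "{v. x v \<noteq> a} \<subseteq> {2 * int s..<int X}"
        using out by (metis (mono_tags, lifting) atLeastLessThan_iff mem_Collect_eq not_le subsetI)
      then have "finite {v. x v \<noteq> a}" using finite_subset by blast
      moreover have "set_decode X \<noteq> {}"
        using \<open>0 < X\<close> by (metis set_decode_inverse set_encode_empty less_nat_zero_code)
      then obtain j b where "prod_encode (j, b) \<in> set_decode X"
        by (metis ex_in_conv prod_decode_inverse surj_pair)
      then have "x (int j) \<noteq> a" using x_exc X(2) by blast
      ultimately show ?thesis unfolding homoclinic_def by blast
    qed
    ultimately show "\<exists>x\<in>avoiding A F. homoclinic x" by blast
  next
    assume "\<exists>x\<in>avoiding A F. homoclinic x"
    then obtain x' where x': "x' \<in> avoiding A F" "homoclinic x'" by blast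
    have "\<bar>v\<bar> \<le> int s" if "p \<in> F" "v \<in> dom p" for p v
      using bound[OF that(1)] that(2) by force
    then obtain x a where x: "x \<in> avoiding A F" and a: "a \<in> A" and x0: "x 0 \<noteq> a"
      and short: "\<And>v. x v \<noteq> a \<Longrightarrow> 0 \<le> v \<and> v < int (card A ^ (2 * s + 1))"
      using short_homoclinic[OF x' fin(1), of s] by metis
    \<comment> \<open>The translate by \<open>2 * s\<close> of the short point, recorded by its
      exceptional positions only.\<close>
    define S where "S = (\<lambda>v. prod_encode (nat v + 2 * s, x v)) ` {v. x v \<noteq> a}"
    have "{v. x v \<noteq> a} \<subseteq> {0..<int (card A ^ (2 * s + 1))}" using short by auto
    then have "finite S" unfolding S_def using finite_subset by blast
    define X where "X = set_encode S"
    have S: "set_decode X = S" using \<open>finite S\<close> by (simp add: X_def)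
    have mem_S: "prod_encode (j, b) \<in> S \<longleftrightarrow> 2 * s \<le> j \<and> b = x (int j - 2 * int s) \<and> b \<noteq> a" for j b
    proof
      assume "prod_encode (j, b) \<in> S"
      then obtain v where "x v \<noteq> a" "j = nat v + 2 * s" "b = x v" by (auto simp: S_def)
      then show "2 * s \<le> j \<and> b = x (int j - 2 * int s) \<and> b \<noteq> a" using short[of v] by simp
    next
      assume "2 * s \<le> j \<and> b = x (int j - 2 * int s) \<and> b \<noteq> a"
      then show "prod_encode (j, b) \<in> S"
        unfolding S_def by (intro image_eqI[of _ _ "int j - 2 * int s"]) auto
    qed
    have letter: "b = x (int j - 2 * int s)" if "letter_at a X j b" for j b
    proof (rule ccontr)
      assume "b \<noteq> x (int j - 2 * int s)"
      with that have "b = a" and none: "\<And>b'. prod_encode (j, b') \<notin> S"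
        using set_decode_prod_less(2)[of j _ X] unfolding letter_at_def S mem_S by blast+
      then have neq: "x (int j - 2 * int s) \<noteq> a" using \<open>b \<noteq> _\<close> by simp
      then have "2 * s \<le> j" using short[of "int j - 2 * int s"] by linarith
      then show False using none[of "x (int j - 2 * int s)"] neq by (simp add: mem_S)
    qed
    have A_less: "b < al" if "b \<in> A" for b
      by (rule set_decode_less) (simp add: decode that)
    have "A \<subseteq> {..<al}" using A_less by blast
    then have "card A \<le> al" using card_mono[of "{..<al}" A] by simp
    have "S \<subseteq> {..<prod_encode (2 * s + al ^ (2 * s + 1), al)}"
    proof
      fix e assume "e \<in> S"
      then obtain v where v: "x v \<noteq> a" "e = prod_encode (nat v + 2 * s, x v)" by (auto simp: S_def)
      have "nat v < card A ^ (2 * s + 1)" using short[OF v(1)] by linarith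
      also have "\<dots> \<le> al ^ (2 * s + 1)" by (rule power_mono) (use \<open>card A \<le> al\<close> in auto)
      finally have "nat v + 2 * s < 2 * s + al ^ (2 * s + 1)" by simp
      moreover have "x v < al" using x by (intro A_less) (auto simp: avoiding_def)
      ultimately show "e \<in> {..<prod_encode (2 * s + al ^ (2 * s + 1), al)}"
        unfolding v(2) by (simp add: prod_encode_strict_mono del: power_Suc)
    qed
    then have "X < 2 ^ prod_encode (2 * s + al ^ (2 * s + 1), al)"
      unfolding X_def by (rule set_encode_less)
    moreover have "exceptions al s a X"
    proof -
      have "prod_encode (2 * s, x 0) \<in> set_decode X" using x0 by (simp add: S mem_S)
      then have "0 < X" using set_decode_less by fastforce
      then show ?thesis
        using x by (auto simp: exceptions_def S mem_S decode avoiding_def)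
    qed
    moreover have "\<not> occurs a X c u" if c: "c \<in> set_decode s" for c u
    proof
      assume occ: "occurs a X c u"
      obtain p where p: "p \<in> F" "c = pattern_code p" using c decode(2) by auto
      have "x (v + (int u - 2 * int s)) = b" if v: "p v = Some b" for v b
      proof -
        have kb: "prod_encode (int_encode v, b) \<in> set_decode c"
          using v by (simp add: p(2) mem_pattern_code dom[OF p(1)])
        with occ set_decode_prod_less[OF kb] obtain j
          where "position u (int_encode v) j" "letter_at a X j b"
          unfolding occurs_def by blast
        then show ?thesis
          using letter[of j b] by (simp add: position_iff algebra_simps)
      qed
      then have "appears p x" unfolding appears_iff by blast
      then show False using x p(1) by (auto simp: avoiding_def)
    qed
    ultimately show "homoclinic_code al s"
      using a A_less unfolding homoclinic_code_def decode by blast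
  qed
qed

section \<open>The decision procedure\<close>

text \<open>The procedure checks that \<open>n\<close> is the code of an SFT, by splitting it and
  testing each pattern code, and then searches for a homoclinic point. All quantifiers are
  bounded.\<close>

lemma embedding_decidable: "decidable_for_sfts (\<lambda>X. halting_subshift \<hookrightarrow> X)"
proof -
  have "sft_code ` {(A, F) \<in> sft_inputs. halting_subshift \<hookrightarrow> avoiding A F} =
    {n. \<exists>al<Suc n. \<exists>s<Suc n. n = prod_encode (al, s)
      \<and> (\<forall>c<s. c \<in> set_decode s \<longrightarrow> pattern_ok al c) \<and> homoclinic_code al s}" (is "?L = ?R")
  proof (intro equalityI subsetI)
    fix n assume "n \<in> ?L"
    then obtain A F where AF: "(A, F) \<in> sft_inputs" "halting_subshift \<hookrightarrow> avoiding A F"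
        "n = sft_code (A, F)" by blast
    define al s where "al = set_encode A" and "s = set_encode (pattern_code ` F)"
    have fin: "finite A" "finite F" "F \<subseteq> patterns A" using AF(1) by (auto simp: sft_inputs_def)
    have n: "n = prod_encode (al, s)" by (simp add: AF(3) sft_code_def al_def s_def)
    have "pattern_ok al c" if "c \<in> set_decode s" for c
      using that fin pattern_code_image[of al] by (auto simp: s_def al_def)
    moreover have "homoclinic_code al s"
      using homoclinic_code_iff[OF AF(1) al_def s_def] embeds_iff_homoclinic[OF AF(1)] AF(2) by blast
    ultimately show "n \<in> ?R"
      using le_prod_encode_1[of al s] le_prod_encode_2[of s al] unfolding n by force
  next
    fix n assume "n \<in> ?R"
    then obtain al s where n: "n = prod_encode (al, s)"
      and ok: "\<And>c. c \<in> set_decode s \<Longrightarrow> pattern_ok al c" and hom: "homoclinic_code al s"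
      using set_decode_less by blast
    \<comment> \<open>The forbidden patterns recovered from their codes; by
      \<open>pattern_ok\<close>, every element of \<open>set_decode s\<close> is the code of
      one.\<close>
    define F where "F = {p \<in> patterns (set_decode al). pattern_code p \<in> set_decode s}"
    have image: "pattern_code ` F = set_decode s"
      using ok pattern_code_image[of al] by (auto simp: F_def)
    have "inj_on pattern_code F"
      by (rule inj_on_subset[OF inj_on_pattern_code]) (auto simp: F_def patterns_def)
    then have "finite F" using image by (metis finite_imageD finite_set_decode)
    then have sft: "(set_decode al, F) \<in> sft_inputs" by (auto simp: sft_inputs_def F_def)
    moreover have "halting_subshift \<hookrightarrow> avoiding (set_decode al) F"
      using homoclinic_code_iff[OF sft, of al s] hom embeds_iff_homoclinic[OF sft]
      by (simp add: image)
    moreover have "n = sft_code (set_decode al, F)" by (simp add: sft_code_def image n)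
    ultimately show "n \<in> ?L" by blast
  qed
  then show ?thesis
    unfolding decidable_for_sfts_def
    by (simp only:) (unfold pattern_ok_def homoclinic_code_def exceptions_def occurs_def
        letter_at_def position_def, intro decidable_set_Collect recursive_intros)
qed

theorem theorem5p4:
  "\<exists>Y. effective_subshift Y
     \<and> decidable_for_sfts (\<lambda>X. Y \<hookrightarrow> X)
     \<and> \<not> computable_patterns (language Y)
     \<and> \<not> decidable_for_sfts (\<lambda>X. Y \<subseteq> X)"
  using effective_halting_subshift embedding_decidable language_not_computable inclusion_undecidable
  by blast

end
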